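(* Let $(G,\tau,\oplus)$ be a (Hausdorff) strongly topological gyrogroup with a symmetric neighborhood base $\mathscr U$ at $0$, and let $H$ be an admissible subgyrogroup of $G$ generated from $\mathscr U$. Suppose that $H$ is neutral. Then the quotient space $G/H$ is metrizable if and only if $G/H$ is Fréchet-Urysohn and has an $\omega^{\omega}$-base.
   Context: A groupoid is a nonempty set with a binary operation; $\mathrm{Aut}(G,\oplus)$ is the set of bijective maps $f:G\to G$ with $f(x\oplus y)=f(x)\oplus f(y)$. A gyrogroup is a groupoid $(G,\oplus)$ such that: (G1) there is a unique $0\in G$ with $0\oplus a=a=a\oplus 0$ for all $a\in G$; (G2) each $x\in G$ has a unique inverse $\ominus x\in G$ with $\ominus x\oplus x=0=x\oplus(\ominus x)$; (G3) for all $x,y\in G$ there is $\mathrm{gyr}[x,y]\in\mathrm{Aut}(G,\oplus)$ with $x\oplus(y\oplus z)=(x\oplus y)\oplus\mathrm{gyr}[x,y](z)$ for all $z\in G$; (G4) $\mathrm{gyr}[x\oplus y,y]=\mathrm{gyr}[x,y]$ for all $x,y\in G$. For $A,B\subset G$, $A\oplus B=\{a\oplus b:a\in A,b\in B\}$ and $\ominus A=\{\ominus a:a\in A\}$; $A$ is symmetric if $\ominus A=A$. A nonempty $H\subset G$ is a subgyrogroup if $\oplus$ restricts to a binary operation on $H$, for all $x,y\in H$ the restriction $\mathrm{gyr}[x,y]|_H:H\to\mathrm{gyr}[x,y](H)$ is a bijective homomorphism, and $(H,\oplus|_{H\times H})$ is a gyrogroup. It is an $L$-subgyrogroup if moreover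 $\mathrm{gyr}[a,h](H)=H$ for all $a\in G$, $h\in H$. A topological gyrogroup is a gyrogroup with a topology $\tau$ such that $\oplus:G\times G\to G$ is jointly continuous and $x\mapsto\ominus x$ is continuous. It is a strongly topological gyrogroup with neighborhood base $\mathscr U$ at $0$ if $\mathscr U$ is a neighborhood base at $0$ with $\mathrm{gyr}[x,y](U)=U$ for all $U\in\mathscr U$ and $x,y\in G$; $\mathscr U$ is symmetric if every $U\in\mathscr U$ is symmetric. A subgyrogroup $H$ of $G$ is admissible if there is a sequence $\{U_n:n\in\omega\}$ of open symmetric neighborhoods of $0$ with $U_{n+1}\oplus(U_{n+1}\oplus U_{n+1})\subset U_n$ for all $n\in\omega$ and $H=\bigcap_{n\in\omega}U_n$; it is generated from $\mathscr U$ if such a sequence can be taken with each $U_n\in\mathscr U$. (Such an $H$ is known to be a closed $L$-subgyrogroup.) For an $L$-subgyrogroup $H$, $G/H=\{a\oplus H:a\in G\}$ is a partition of $G$; $\pi:G\to G/H$, $\pi(a)=a\oplus H$, and $G/H$ carries the quotient topology ($O$ is open iff $\pi^{-1}(O)$ is open in $G$). All topological spaces are assumed Hausdorff. An $L$-subgyrogroup $H$ of $G$ is neutral if for every open neighborhood $U$ of $0$ in $G$ there is an open neighborhood $V$ of $0$ with $H\oplus V\subset U\oplus H$. A space $X$ is Fréchet-Urysohn if for every $A\subset X$ and $x\in\overline A$ there is a sequence in $A$ converging to $x$. A space $X$ has an $\omega^{\omega}$-base if every $x\in X$ has a base of neighborhoods of the form $\{U_\alpha(x):\alpha\in\mathbb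 N^{\mathbb N}\}$ with $U_\beta(x)\subset U_\alpha(x)$ whenever $\alpha\le\beta$, where $\mathbb N^{\mathbb N}$ has the pointwise partial order ($\alpha\le\beta$ iff $\alpha(n)\le\beta(n)$ for all $n\in\mathbb N$). *)

theory Defs
  imports "HOL-Analysis.Analysis"
begin

section \<open>Gyrogroups\<close>

definition gyro_aut :: "'a set \<Rightarrow> ('a \<Rightarrow> 'a \<Rightarrow> 'a) \<Rightarrow> ('a \<Rightarrow> 'a) set" where
  "gyro_aut G oplus =
     {f. bij_betw f G G \<and> (\<forall>x\<in>G. \<forall>y\<in>G. f (oplus x y) = oplus (f x) (f y))}"

definition gyro_zero :: "'a set \<Rightarrow> ('a \<Rightarrow> 'a \<Rightarrow> 'a) \<Rightarrow> 'a" where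
  "gyro_zero G oplus = (THE e. e \<in> G \<and> (\<forall>a\<in>G. oplus e a = a \<and> oplus a e = a))"

definition gyro_inv :: "'a set \<Rightarrow> ('a \<Rightarrow> 'a \<Rightarrow> 'a) \<Rightarrow> 'a \<Rightarrow> 'a" where
  "gyro_inv G oplus x =
     (THE y. y \<in> G \<and> oplus y x = gyro_zero G oplus \<and> oplus x y = gyro_zero G oplus)"

text \<open>Only the values of \<open>gyr x y z\<close> with all three arguments in \<open>G\<close> matter; there they are
  determined by \<open>\<oplus>\<close>, since (G1)--(G3) imply left cancellation.\<close>

locale gyrogroup =
  fixes G :: "'a set"
    and oplus :: "'a \<Rightarrow> 'a \<Rightarrow> 'a"  (infixl \<open>\<oplus>\<close> 65)
    and gyr :: "'a \<Rightarrow> 'a \<Rightarrow> 'a \<Rightarrow> 'a"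
  assumes nonempty: "G \<noteq> {}"
    and closed: "x \<in> G \<Longrightarrow> y \<in> G \<Longrightarrow> x \<oplus> y \<in> G"
    and G1: "\<exists>!e. e \<in> G \<and> (\<forall>a\<in>G. e \<oplus> a = a \<and> a \<oplus> e = a)"
    and G2: "x \<in> G \<Longrightarrow>
               \<exists>!y. y \<in> G \<and> y \<oplus> x = gyro_zero G oplus \<and> x \<oplus> y = gyro_zero G oplus"
    and G3_aut: "x \<in> G \<Longrightarrow> y \<in> G \<Longrightarrow> gyr x y \<in> gyro_aut G oplus"
    and G3: "x \<in> G \<Longrightarrow> y \<in> G \<Longrightarrow> z \<in> G \<Longrightarrow> x \<oplus> (y \<oplus> z) = (x \<oplus> y) \<oplus> gyr x y z"
    and G4: "x \<in> G \<Longrightarrow> y \<in> G \<Longrightarrow> z \<in> G \<Longrightarrow> gyr (x \<oplus> y) y z = gyr x y z"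

definition set_oplus :: "('a \<Rightarrow> 'a \<Rightarrow> 'a) \<Rightarrow> 'a set \<Rightarrow> 'a set \<Rightarrow> 'a set" where
  "set_oplus oplus A B = {oplus a b | a b. a \<in> A \<and> b \<in> B}"

definition symmetric_in :: "'a set \<Rightarrow> ('a \<Rightarrow> 'a \<Rightarrow> 'a) \<Rightarrow> 'a set \<Rightarrow> bool" where
  "symmetric_in G oplus A \<longleftrightarrow> A \<subseteq> G \<and> gyro_inv G oplus ` A = A"

definition subgyrogroup ::
  "'a set \<Rightarrow> ('a \<Rightarrow> 'a \<Rightarrow> 'a) \<Rightarrow> ('a \<Rightarrow> 'a \<Rightarrow> 'a \<Rightarrow> 'a) \<Rightarrow> 'a set \<Rightarrow> bool" where
  "subgyrogroup G oplus gyr H \<longleftrightarrow>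
     H \<noteq> {} \<and> H \<subseteq> G \<and>
     (\<forall>x\<in>H. \<forall>y\<in>H. oplus x y \<in> H) \<and>
     (\<forall>x\<in>H. \<forall>y\<in>H. bij_betw (gyr x y) H (gyr x y ` H) \<and>
        (\<forall>a\<in>H. \<forall>b\<in>H. gyr x y (oplus a b) = oplus (gyr x y a) (gyr x y b))) \<and>
     (\<exists>gyr'. gyrogroup H oplus gyr')"

definition L_subgyrogroup ::
  "'a set \<Rightarrow> ('a \<Rightarrow> 'a \<Rightarrow> 'a) \<Rightarrow> ('a \<Rightarrow> 'a \<Rightarrow> 'a \<Rightarrow> 'a) \<Rightarrow> 'a set \<Rightarrow> bool" where
  "L_subgyrogroup G oplus gyr H \<longleftrightarrow>
     subgyrogroup G oplus gyr H \<and> (\<forall>a\<in>G. \<forall>h\<in>H. gyr a h ` H = H)"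


section \<open>Topological notions\<close>

text \<open>Neighbourhoods need not be open, and all members of a base at \<open>x\<close> are required to be
  neighbourhoods of \<open>x\<close> (which \<^const>\<open>neighbourhood_base_at\<close> alone does not demand).\<close>

definition nhd_of :: "'a topology \<Rightarrow> 'a \<Rightarrow> 'a set \<Rightarrow> bool" where
  "nhd_of X x N \<longleftrightarrow> N \<subseteq> topspace X \<and> (\<exists>W. openin X W \<and> x \<in> W \<and> W \<subseteq> N)"

definition nhd_base_at :: "'a topology \<Rightarrow> 'a \<Rightarrow> 'a set set \<Rightarrow> bool" where
  "nhd_base_at X x \<B> \<longleftrightarrow>
     (\<forall>N\<in>\<B>. nhd_of X x N) \<and> neighbourhood_base_at x (\<lambda>N. N \<in> \<B>) X"

definition frechet_urysohn_space :: "'a topology \<Rightarrow> bool" where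
  "frechet_urysohn_space X \<longleftrightarrow>
     (\<forall>A x. A \<subseteq> topspace X \<and> x \<in> X closure_of A \<longrightarrow>
        (\<exists>s :: nat \<Rightarrow> 'a. (\<forall>n. s n \<in> A) \<and> limitin X s x sequentially))"

text \<open>The order on \<^typ>\<open>nat \<Rightarrow> nat\<close> is the pointwise one.\<close>

definition has_omega_omega_base :: "'a topology \<Rightarrow> bool" where
  "has_omega_omega_base X \<longleftrightarrow>
     (\<forall>x\<in>topspace X. \<exists>U :: (nat \<Rightarrow> nat) \<Rightarrow> 'a set.
        nhd_base_at X x (range U) \<and> (\<forall>\<alpha> \<beta>. \<alpha> \<le> \<beta> \<longrightarrow> U \<beta> \<subseteq> U \<alpha>))"


section \<open>Topological gyrogroups\<close>

locale topological_gyrogroup = gyrogroup "topspace T" oplus gyr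
  for T :: "'a topology"
    and oplus :: "'a \<Rightarrow> 'a \<Rightarrow> 'a"  (infixl \<open>\<oplus>\<close> 65)
    and gyr :: "'a \<Rightarrow> 'a \<Rightarrow> 'a \<Rightarrow> 'a" +
  assumes continuous_oplus: "continuous_map (prod_topology T T) T (\<lambda>(x, y). x \<oplus> y)"
    and continuous_inv: "continuous_map T T (gyro_inv (topspace T) oplus)"

locale strongly_topological_gyrogroup = topological_gyrogroup T oplus gyr
  for T :: "'a topology"
    and oplus :: "'a \<Rightarrow> 'a \<Rightarrow> 'a"  (infixl \<open>\<oplus>\<close> 65)
    and gyr :: "'a \<Rightarrow> 'a \<Rightarrow> 'a \<Rightarrow> 'a"
    and \<U> :: "'a set set" +
  assumes nhd_base: "nhd_base_at T (gyro_zero (topspace T) oplus) \<U>"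
    and gyr_invariant:
      "U \<in> \<U> \<Longrightarrow> x \<in> topspace T \<Longrightarrow> y \<in> topspace T \<Longrightarrow> gyr x y ` U = U"

definition admissible_sequence ::
  "'a topology \<Rightarrow> ('a \<Rightarrow> 'a \<Rightarrow> 'a) \<Rightarrow> 'a set \<Rightarrow> (nat \<Rightarrow> 'a set) \<Rightarrow> bool" where
  "admissible_sequence T oplus H U \<longleftrightarrow>
     (\<forall>n. openin T (U n) \<and> gyro_zero (topspace T) oplus \<in> U n \<and>
          symmetric_in (topspace T) oplus (U n)) \<and>
     (\<forall>n. set_oplus oplus (U (Suc n)) (set_oplus oplus (U (Suc n)) (U (Suc n))) \<subseteq> U n) \<and>
     H = (\<Inter>n. U n)"

definition admissible_subgyrogroup ::
  "'a topology \<Rightarrow> ('a \<Rightarrow> 'a \<Rightarrow> 'a) \<Rightarrow> ('a \<Rightarrow> 'a \<Rightarrow> 'a \<Rightarrow> 'a) \<Rightarrow> 'a set \<Rightarrow> bool" where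
  "admissible_subgyrogroup T oplus gyr H \<longleftrightarrow>
     subgyrogroup (topspace T) oplus gyr H \<and> (\<exists>U. admissible_sequence T oplus H U)"

definition generated_from ::
  "'a topology \<Rightarrow> ('a \<Rightarrow> 'a \<Rightarrow> 'a) \<Rightarrow> 'a set \<Rightarrow> 'a set set \<Rightarrow> bool" where
  "generated_from T oplus H \<U> \<longleftrightarrow>
     (\<exists>U. admissible_sequence T oplus H U \<and> (\<forall>n. U n \<in> \<U>))"

definition neutral_subgyrogroup ::
  "'a topology \<Rightarrow> ('a \<Rightarrow> 'a \<Rightarrow> 'a) \<Rightarrow> ('a \<Rightarrow> 'a \<Rightarrow> 'a \<Rightarrow> 'a) \<Rightarrow> 'a set \<Rightarrow> bool" where
  "neutral_subgyrogroup T oplus gyr H \<longleftrightarrow>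
     L_subgyrogroup (topspace T) oplus gyr H \<and>
     (\<forall>U. openin T U \<and> gyro_zero (topspace T) oplus \<in> U \<longrightarrow>
        (\<exists>V. openin T V \<and> gyro_zero (topspace T) oplus \<in> V \<and>
             set_oplus oplus H V \<subseteq> set_oplus oplus U H))"


section \<open>The quotient space\<close>

definition left_coset :: "('a \<Rightarrow> 'a \<Rightarrow> 'a) \<Rightarrow> 'a set \<Rightarrow> 'a \<Rightarrow> 'a set" where
  "left_coset oplus H a = oplus a ` H"

definition quotient_topology :: "'a topology \<Rightarrow> ('a \<Rightarrow> 'b) \<Rightarrow> 'b topology" where
  "quotient_topology T p =
     topology (\<lambda>W. W \<subseteq> p ` topspace T \<and> openin T {x \<in> topspace T. p x \<in> W})"

lemma openin_quotient_topology:
  "openin (quotient_topology T p) W \<longleftrightarrow>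
     W \<subseteq> p ` topspace T \<and> openin T {x \<in> topspace T. p x \<in> W}"
proof -
  have "istopology (\<lambda>W. W \<subseteq> p ` topspace T \<and> openin T {x \<in> topspace T. p x \<in> W})"
    unfolding istopology_def
  proof (intro conjI allI impI)
    fix S W assume "S \<subseteq> p ` topspace T \<and> openin T {x \<in> topspace T. p x \<in> S}"
      "W \<subseteq> p ` topspace T \<and> openin T {x \<in> topspace T. p x \<in> W}"
    then have "openin T ({x \<in> topspace T. p x \<in> S} \<inter> {x \<in> topspace T. p x \<in> W})"
      by blast
    moreover have "{x \<in> topspace T. p x \<in> S} \<inter> {x \<in> topspace T. p x \<in> W}
        = {x \<in> topspace T. p x \<in> S \<inter> W}" by blast
    ultimately show "openin T {x \<in> topspace T. p x \<in> S \<inter> W}" by simp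
  next
    fix \<K> assume "\<forall>K\<in>\<K>. K \<subseteq> p ` topspace T \<and> openin T {x \<in> topspace T. p x \<in> K}"
    then have "openin T (\<Union>K\<in>\<K>. {x \<in> topspace T. p x \<in> K})" by blast
    moreover have "(\<Union>K\<in>\<K>. {x \<in> topspace T. p x \<in> K}) = {x \<in> topspace T. p x \<in> \<Union>\<K>}"
      by blast
    ultimately show "openin T {x \<in> topspace T. p x \<in> \<Union>\<K>}" by simp
  qed blast+
  then show ?thesis
    by (simp add: quotient_topology_def topology_inverse')
qed

lemma topspace_quotient_topology: "topspace (quotient_topology T p) = p ` topspace T"
proof
  show "topspace (quotient_topology T p) \<subseteq> p ` topspace T"
    using openin_quotient_topology[of T p "topspace (quotient_topology T p)"] by simp
  have "{x \<in> topspace T. p x \<in> p ` topspace T} = topspace T" by blast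
  then have "openin (quotient_topology T p) (p ` topspace T)"
    by (simp add: openin_quotient_topology)
  then show "p ` topspace T \<subseteq> topspace (quotient_topology T p)"
    by (rule openin_subset)
qed

lemma quotient_map_quotient_topology: "quotient_map T (quotient_topology T p) p"
  by (simp add: quotient_map_def topspace_quotient_topology openin_quotient_topology)

definition coset_space :: "'a topology \<Rightarrow> ('a \<Rightarrow> 'a \<Rightarrow> 'a) \<Rightarrow> 'a set \<Rightarrow> 'a set topology" where
  "coset_space T oplus H = quotient_topology T (left_coset oplus H)"

end

theory Submission
  imports Defs
begin

text \<open>Products of gyration-stable sets associate, so for \<open>W\<close> in the base the relation
  \<open>b \<in> a \<oplus> (W \<oplus> H)\<close> induces relations on \<open>G/H\<close> that are invariant under left translations; by neutrality
  they form a base of a separated uniformity inducing the quotient topology, and left translations act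
  transitively by uniform isomorphisms. In such a homogeneous space the Frechet-Urysohn property allows
  diagonal selection from countably many sequences with a common limit, and together with an
  \<open>\<omega>\<^sup>\<omega>\<close>-base this gives a countable base at one point. By homogeneity the uniformity then has a
  countable base, hence is metrizable.\<close>

subsection \<open>Metrization of countable uniformities\<close>

text \<open>Frink's construction: \<open>d x y\<close> is the infimum of the lengths of the chains from \<open>x\<close> to \<open>y\<close>, where
  a step \<open>(x, y)\<close> costs \<open>(1/2) ^ n\<close> for the least \<open>n\<close> with \<open>(x, y) \<notin> E n\<close>.\<close>

lemma chain_metric:
  fixes E :: "nat \<Rightarrow> 'b rel"
  assumes refl: "\<And>n x. (x, x) \<in> E n"
    and sym: "\<And>n x y. (x, y) \<in> E n \<Longrightarrow> (y, x) \<in> E n"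
    and comp: "\<And>n. E (Suc n) O E (Suc n) O E (Suc n) \<subseteq> E n"
  obtains d :: "'b \<Rightarrow> 'b \<Rightarrow> real" where
    "\<And>x y. 0 \<le> d x y" "\<And>x. d x x = 0" "\<And>x y. d x y = d y x"
    "\<And>x y z. d x z \<le> d x y + d y z"
    "\<And>n x y. (x, y) \<in> E n \<Longrightarrow> d x y < (1/2) ^ n"
    "\<And>n x y. d x y < (1/2) ^ Suc n \<Longrightarrow> (x, y) \<in> E n"
proof -
  have dec1: "E (Suc n) \<subseteq> E n" for n
  proof (rule subrelI)
    fix x y assume "(x, y) \<in> E (Suc n)"
    with refl[of x "Suc n"] refl[of y "Suc n"] have "(x, y) \<in> E (Suc n) O E (Suc n) O E (Suc n)"
      by blast
    with comp show "(x, y) \<in> E n" by blast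
  qed
  have dec: "E n \<subseteq> E m" if "m \<le> n" for m n
    using lift_Suc_antimono_le[of E, OF dec1 that] by simp
  define f :: "'b \<Rightarrow> 'b \<Rightarrow> real" where
    "f x y = (if \<forall>n. (x, y) \<in> E n then 0 else (1/2) ^ (LEAST n. (x, y) \<notin> E n))" for x y
  have f_less: "f x y < (1/2) ^ n \<longleftrightarrow> (x, y) \<in> E n" for x y n
  proof (cases "\<forall>n. (x, y) \<in> E n")
    case True
    then show ?thesis by (simp add: f_def)
  next
    case False
    define N where "N = (LEAST n. (x, y) \<notin> E n)"
    have N: "(x, y) \<notin> E N"
      using False unfolding N_def by (metis (mono_tags, lifting) LeastI)
    have "(x, y) \<in> E n \<longleftrightarrow> n < N"
    proof
      assume "(x, y) \<in> E n"
      then show "n < N" using N dec[of N n] by (meson not_le subsetD)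
    next
      assume "n < N"
      then show "(x, y) \<in> E n" unfolding N_def using not_less_Least by blast
    qed
    moreover have "f x y = (1/2) ^ N"
      using False by (auto simp: f_def N_def)
    ultimately show ?thesis by simp
  qed
  have f_nonneg: "0 \<le> f x y" for x y
    by (simp add: f_def)
  have f_refl: "f x x = 0" for x
    using refl by (simp add: f_def)
  have f_sym: "f x y = f y x" for x y
  proof -
    have "(x, y) \<in> E n \<longleftrightarrow> (y, x) \<in> E n" for n
      using sym by blast
    then show ?thesis by (simp add: f_def)
  qed
  \<comment> \<open>Nonzero costs are powers of 1/2. If \<open>f x u = (1/2) ^ N\<close> exceeded
    \<open>2 * e\<close>, then \<open>e\<close> would lie below \<open>(1/2) ^ Suc N\<close>, all
    three steps would lie in \<open>E (Suc N)\<close>, and \<open>comp\<close> would put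
    \<open>(x, u)\<close> into \<open>E N\<close>.\<close>
  have f_three: "f x u \<le> 2 * e" if "f x y \<le> e" "f y z \<le> e" "f z u \<le> e" for x y z u e
  proof (rule ccontr)
    assume less: "\<not> f x u \<le> 2 * e"
    have "0 \<le> e" using that(1) f_nonneg[of x y] by linarith
    with less have "f x u \<noteq> 0" by auto
    then obtain N where N: "f x u = (1/2) ^ N"
      by (metis f_def)
    with less have "e < (1/2) ^ Suc N" by simp
    then have "(x, y) \<in> E (Suc N)" "(y, z) \<in> E (Suc N)" "(z, u) \<in> E (Suc N)"
      using that f_less by (meson le_less_trans)+
    then have "(x, u) \<in> E N" using comp by blast
    with f_less N show False by force
  qed
  define L where "L s n = (\<Sum>i<n. f (s i) (s (Suc i)))" for s :: "nat \<Rightarrow> 'b" and n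
  have L_nonneg: "0 \<le> L s n" for s n
    by (simp add: L_def sum_nonneg f_nonneg)
  have L_add: "L s (m + n) = L s m + L (\<lambda>i. s (m + i)) n" for s m n
  proof (induction n)
    case 0
    then show ?case by (simp add: L_def)
  next
    case (Suc n)
    then show ?case by (simp add: L_def)
  qed
  have chain: "f (s 0) (s n) \<le> 2 * L s n" for s n
  proof (induction n arbitrary: s rule: less_induct)
    case (less n)
    show ?case
    proof (cases "n = 0")
      case True
      then show ?thesis by (simp add: f_refl L_def)
    next
      case False
      txt \<open>The step \<open>k\<close> at which the partial sums cross half of the total length.\<close>
      define k where "k = (LEAST k. L s n / 2 \<le> L s (Suc k))"
      have "L s n / 2 \<le> L s (Suc (n - 1))"
        using False L_nonneg[of s n] by simp
      then have k: "L s n / 2 \<le> L s (Suc k)" and "k \<le> n - 1"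
        unfolding k_def by (rule LeastI, rule Least_le)
      then have "k < n" using False by simp
      then have n: "n = Suc k + (n - Suc k)" by simp
      have 1: "L s k \<le> L s n / 2"
      proof (cases k)
        case 0
        then show ?thesis using L_nonneg[of s n] by (simp add: L_def)
      next
        case (Suc j)
        then have "\<not> L s n / 2 \<le> L s (Suc j)"
          unfolding k_def by (metis k_def lessI not_less_Least)
        then show ?thesis using Suc by simp
      qed
      have eq: "L s n = L s (Suc k) + L (\<lambda>i. s (Suc k + i)) (n - Suc k)"
        using L_add[of s "Suc k" "n - Suc k"] n by simp
      \<comment> \<open>Each outer part has at most half of the total length, which absorbs the
        factor 2 of the induction hypothesis; the middle step costs at most the whole.
        \<open>f_three\<close> then restores the factor 2.\<close>
      have A: "f (s 0) (s k) \<le> L s n"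
        using less.IH[OF \<open>k < n\<close>, of s] 1 by simp
      have "f (s (Suc k)) (s n) \<le> 2 * L (\<lambda>i. s (Suc k + i)) (n - Suc k)"
        using less.IH[of "n - Suc k" "\<lambda>i. s (Suc k + i)"] \<open>k < n\<close> by simp
      then have C: "f (s (Suc k)) (s n) \<le> L s n"
        using eq k by simp
      have "f (s k) (s (Suc k)) \<le> L s (Suc k)"
        using L_nonneg[of s k] by (simp add: L_def)
      then have B: "f (s k) (s (Suc k)) \<le> L s n"
        using eq L_nonneg[of "\<lambda>i. s (Suc k + i)" "n - Suc k"] by simp
      show ?thesis by (rule f_three[OF A B C])
    qed
  qed
  define C where "C x y = {L s n | s n. s 0 = x \<and> s n = y}" for x y
  define d where "d x y = Inf (C x y)" for x y
  have C_bdd: "bdd_below (C x y)" for x y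
    by (rule bdd_belowI[of _ 0]) (auto simp: C_def L_nonneg)
  have f_in: "f x y \<in> C x y" for x y
    unfolding C_def by (rule CollectI, rule exI[of _ "\<lambda>i. if i = 0 then x else y"], rule exI[of _ 1])
      (simp add: L_def)
  have d_lower: "d x y \<le> c" if "c \<in> C x y" for x y c
    unfolding d_def by (rule cInf_lower[OF that C_bdd])
  have d_greatest: "c \<le> d x y" if "\<And>l. l \<in> C x y \<Longrightarrow> c \<le> l" for x y c
    unfolding d_def using f_in[of x y] that by (intro cInf_greatest) auto
  have f_le: "f x y \<le> 2 * d x y" for x y
  proof -
    have "f x y / 2 \<le> d x y"
    proof (rule d_greatest)
      fix l assume "l \<in> C x y"
      then obtain s n where "l = L s n" "s 0 = x" "s n = y"
        by (auto simp: C_def)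
      then show "f x y / 2 \<le> l" using chain[of s n] by simp
    qed
    then show ?thesis by simp
  qed
  have d_le: "d x y \<le> f x y" for x y
    by (rule d_lower[OF f_in])
  have d_nonneg: "0 \<le> d x y" for x y
    using f_le[of x y] f_nonneg[of x y] by simp
  have C_sym: "C x y \<subseteq> C y x" for x y
  proof
    fix l assume "l \<in> C x y"
    then obtain s n where s: "l = L s n" "s 0 = x" "s n = y"
      by (auto simp: C_def)
    have "L (\<lambda>i. s (n - i)) n = (\<Sum>i<n. f (s (Suc (n - Suc i))) (s (n - Suc i)))"
      unfolding L_def by (rule sum.cong) (auto simp: Suc_diff_Suc)
    also have "\<dots> = (\<Sum>i<n. f (s (Suc i)) (s i))"
      by (rule sum.nat_diff_reindex)
    also have "\<dots> = l"
      unfolding s L_def by (rule sum.cong) (auto intro: f_sym)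
    finally show "l \<in> C y x"
      using s unfolding C_def
      by (intro CollectI exI[of _ "\<lambda>i. s (n - i)"] exI[of _ n]) auto
  qed
  have tri: "d x z \<le> d x y + d y z" for x y z
  proof -
    have 1: "d x z \<le> a + b" if a: "a \<in> C x y" and b: "b \<in> C y z" for a b
    proof -
      obtain s m where s: "a = L s m" "s 0 = x" "s m = y"
        using a by (auto simp: C_def)
      obtain t n where t: "b = L t n" "t 0 = y" "t n = z"
        using b by (auto simp: C_def)
      define r where "r i = (if i < m then s i else t (i - m))" for i
      have "r i = s i" if "i \<le> m" for i
        using that s t by (cases "i = m") (auto simp: r_def)
      then have "L r m = a"
        unfolding s L_def by (intro sum.cong) auto
      moreover have "L (\<lambda>i. r (m + i)) n = b"
        unfolding t L_def by (intro sum.cong) (auto simp: r_def)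
      ultimately have "L r (m + n) = a + b" by (simp add: L_add)
      moreover have "r 0 = x" "r (m + n) = z"
        using s t by (auto simp: r_def)
      ultimately have "a + b \<in> C x z" unfolding C_def by force
      then show ?thesis by (rule d_lower)
    qed
    \<comment> \<open>The two infima are taken one after the other, each time with the other summand
      moved to the left.\<close>
    have "d x z - b \<le> d x y" if "b \<in> C y z" for b
      using 1[OF _ that] by (intro d_greatest) (simp add: le_diff_eq algebra_simps)
    then have "d x z - d x y \<le> d y z"
      by (intro d_greatest) (simp add: algebra_simps)
    then show ?thesis by simp
  qed
  show ?thesis
  proof (rule that[of d])
    show "d x x = 0" for x
      using d_le[of x x] d_nonneg[of x x] f_refl[of x] by simp
    have "C x y = C y x" for x y
      using C_sym by blast
    then show "d x y = d y x" for x y by (simp add: d_def)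
    show "d x y < (1/2) ^ n" if "(x, y) \<in> E n" for n x y
      using f_less d_le that by (meson le_less_trans)
    \<comment> \<open>The factor 2 in \<open>f_le\<close> costs one power of 1/2, hence the shift
      from \<open>Suc n\<close> to \<open>n\<close>.\<close>
    show "(x, y) \<in> E n" if "d x y < (1/2) ^ Suc n" for n x y
    proof -
      have "f x y < (1/2) ^ n" using f_le[of x y] that by simp
      then show ?thesis using f_less by blast
    qed
  qed (use d_nonneg tri in auto)
qed

subsection \<open>Frechet-Urysohn spaces and bases indexed by sequences\<close>

lemma metrizable_imp_frechet_urysohn_space:
  assumes "metrizable_space X"
  shows "frechet_urysohn_space X"
proof -
  obtain M d where "Metric_space M d" and X: "X = Metric_space.mtopology M d"
    using assms by (auto simp: metrizable_space_def)
  then interpret Metric_space M d by simp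
  show ?thesis
    unfolding frechet_urysohn_space_def
  proof (intro allI impI, elim conjE)
    fix A x assume "x \<in> X closure_of A"
    then have x: "x \<in> M" and A: "\<And>r. r > 0 \<Longrightarrow> \<exists>y\<in>A. y \<in> mball x r"
      unfolding X metric_closure_of by blast+
    have "\<forall>n. \<exists>y. y \<in> A \<and> y \<in> mball x (1 / real (Suc n))"
      using A[of "1 / real (Suc n)" for n] by auto
    then obtain s where s: "\<And>n. s n \<in> A" "\<And>n. s n \<in> mball x (1 / real (Suc n))"
      by metis
    have "limitin X s x sequentially"
      unfolding X limitin_metric
    proof (intro conjI x allI impI)
      fix e :: real assume "e > 0"
      then obtain N where N: "1 / real (Suc N) < e"
        using nat_approx_posE by auto
      have "s n \<in> M \<and> d (s n) x < e" if "N \<le> n" for n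
      proof -
        have "1 / real (Suc n) \<le> 1 / real (Suc N)"
          using that by (simp add: frac_le)
        then show ?thesis
          using s(2)[of n] N by (auto simp: commute)
      qed
      then show "\<forall>\<^sub>F n in sequentially. s n \<in> M \<and> d (s n) x < e"
        by (auto simp: eventually_sequentially)
    qed
    with s(1) show "\<exists>s. (\<forall>n. s n \<in> A) \<and> limitin X s x sequentially"
      by blast
  qed
qed

lemma metrizable_imp_omega_omega_base:
  assumes "metrizable_space X"
  shows "has_omega_omega_base X"
proof -
  obtain M d where "Metric_space M d" and X: "X = Metric_space.mtopology M d"
    using assms by (auto simp: metrizable_space_def)
  then interpret Metric_space M d by simp
  show ?thesis
    unfolding has_omega_omega_base_def
  proof (rule ballI)
    fix x assume "x \<in> topspace X"
    then have x: "x \<in> M" by (simp add: X)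
    \<comment> \<open>A decreasing countable base becomes one indexed by sequences if only the entry
      \<open>\<alpha> 0\<close> is read.\<close>
    define U where "U \<alpha> = mball x (1 / real (Suc (\<alpha> 0)))" for \<alpha> :: "nat \<Rightarrow> nat"
    have op: "openin X (U \<alpha>)" "x \<in> U \<alpha>" for \<alpha>
      using x by (simp_all add: U_def X)
    have "\<exists>\<alpha>. U \<alpha> \<subseteq> W" if W: "openin X W" "x \<in> W" for W
    proof -
      obtain e where "e > 0" and e: "mball x e \<subseteq> W"
        using W by (auto simp: X openin_mtopology)
      then obtain N where "1 / real (Suc N) < e"
        using nat_approx_posE by auto
      then have "U (\<lambda>_. N) \<subseteq> mball x e"
        unfolding U_def by (intro mball_subset_concentric) simp
      with e show ?thesis by blast
    qed
    moreover have "nhd_of X x (U \<alpha>)" for \<alpha>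
      using op[of \<alpha>] openin_subset unfolding nhd_of_def by blast
    ultimately have base: "nhd_base_at X x (range U)"
      unfolding nhd_base_at_def neighbourhood_base_at_def using op
      by (metis (no_types, lifting) order_refl rangeE rangeI)
    have "U \<beta> \<subseteq> U \<alpha>" if "\<alpha> \<le> \<beta>" for \<alpha> \<beta>
    proof -
      have "\<alpha> 0 \<le> \<beta> 0" using that by (simp add: le_fun_def)
      then show ?thesis
        unfolding U_def by (intro mball_subset_concentric) (simp add: frac_le)
    qed
    with base show "\<exists>U :: (nat \<Rightarrow> nat) \<Rightarrow> _. nhd_base_at X x (range U) \<and> (\<forall>\<alpha> \<beta>. \<alpha> \<le> \<beta> \<longrightarrow> U \<beta> \<subseteq> U \<alpha>)"
      by blast
  qed
qed

text \<open>The sets \<open>D l\<close>, intersections of all \<open>U \<beta>\<close> with \<open>\<beta>\<close> extending the finite sequence \<open>l\<close>, form a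
  countable family; if no \<open>D (\<alpha>|k)\<close> were a neighbourhood, a diagonal sequence would avoid some \<open>U \<gamma>\<close>.\<close>

lemma countable_nhd_base_if_diagonal:
  fixes X :: "'b topology" and U :: "(nat \<Rightarrow> nat) \<Rightarrow> 'b set"
  assumes fu: "frechet_urysohn_space X"
    and x: "x \<in> topspace X"
    and base: "nhd_base_at X x (range U)"
    and anti: "\<And>\<alpha> \<beta>. \<alpha> \<le> \<beta> \<Longrightarrow> U \<beta> \<subseteq> U \<alpha>"
    and diagonal: "\<And>s :: nat \<Rightarrow> nat \<Rightarrow> 'b.
      (\<And>k m. s k m \<in> topspace X - {x}) \<Longrightarrow> (\<And>k. limitin X (s k) x sequentially) \<Longrightarrow>
      \<exists>k m. filterlim k at_top sequentially \<and> limitin X (\<lambda>i. s (k i) (m i)) x sequentially"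
  obtains \<B> where "countable \<B>" "nhd_base_at X x \<B>"
proof -
  have nhdU: "nhd_of X x (U \<alpha>)" for \<alpha>
    using base by (auto simp: nhd_base_at_def)
  define D where "D l = (\<Inter>\<beta>\<in>{\<beta>. map \<beta> [0..<length l] = l}. U \<beta>)" for l :: "nat list"
  have D_eq: "D (map \<alpha> [0..<k]) = (\<Inter>\<beta>\<in>{\<beta>. \<forall>j<k. \<beta> j = \<alpha> j}. U \<beta>)" for \<alpha> k
    by (simp add: D_def Ball_def)
  have D_sub: "D (map \<alpha> [0..<k]) \<subseteq> U \<alpha>" for \<alpha> k
    by (auto simp: D_eq)
  have D_nhd: "\<exists>k. nhd_of X x (D (map \<alpha> [0..<k]))" for \<alpha>
  proof (rule ccontr)
    assume neg: "\<nexists>k. nhd_of X x (D (map \<alpha> [0..<k]))"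
    \<comment> \<open>Since \<open>D\<close> at this index is not a neighbourhood of
      \<open>x\<close>, every open set around \<open>x\<close> meets its complement.\<close>
    have "\<exists>s. (\<forall>m. s m \<in> topspace X - D (map \<alpha> [0..<k])) \<and> limitin X s x sequentially" for k
    proof -
      have "D (map \<alpha> [0..<k]) \<subseteq> topspace X"
        using D_sub nhdU unfolding nhd_of_def by blast
      then have "x \<in> X closure_of (topspace X - D (map \<alpha> [0..<k]))"
        using neg x unfolding in_closure_of nhd_of_def by (metis DiffI openin_subset subset_iff)
      then show ?thesis
        using fu unfolding frechet_urysohn_space_def by (meson Diff_subset)
    qed
    then obtain s where s: "\<And>k m. s k m \<in> topspace X - D (map \<alpha> [0..<k])"
      and lim: "\<And>k. limitin X (s k) x sequentially"
      by metis
    \<comment> \<open>The sequences have to avoid \<open>x\<close> before \<open>diagonal\<close>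
      applies; they do, because they avoid a set containing \<open>x\<close>.\<close>
    have "x \<in> D l" for l
      using nhdU by (auto simp: D_def nhd_of_def)
    then have "s k m \<in> topspace X - {x}" for k m
      using s[of k m] by auto
    note ex = diagonal[of s, OF this lim]
    obtain k m where k: "filterlim k at_top sequentially"
      and diag: "limitin X (\<lambda>i. s (k i) (m i)) x sequentially"
      using ex by (elim exE conjE)
    have "\<exists>\<beta>. (\<forall>j<k i. \<beta> j = \<alpha> j) \<and> s (k i) (m i) \<notin> U \<beta>" for i
      using s[of "k i" "m i"] by (auto simp: D_eq)
    then obtain \<beta> where \<beta>: "\<And>i j. j < k i \<Longrightarrow> \<beta> i j = \<alpha> j" "\<And>i. s (k i) (m i) \<notin> U (\<beta> i)"
      by metis
    txt \<open>Only finitely many \<open>\<beta> i\<close> differ from \<open>\<alpha>\<close> at a given place, so they have a common bound.\<close>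
    have fin: "finite (range (\<lambda>i. \<beta> i j))" for j
    proof -
      have "\<forall>\<^sub>F i in sequentially. j < k i"
        using k unfolding filterlim_at_top by (meson Suc_le_eq eventually_mono)
      then obtain N where N: "\<And>i. i \<ge> N \<Longrightarrow> j < k i"
        by (auto simp: eventually_sequentially)
      have "range (\<lambda>i. \<beta> i j) \<subseteq> insert (\<alpha> j) ((\<lambda>i. \<beta> i j) ` {..<N})"
      proof clarify
        fix i assume "\<beta> i j \<notin> (\<lambda>i. \<beta> i j) ` {..<N}"
        then show "\<beta> i j = \<alpha> j"
          using N[of i] \<beta>(1)[of j i] by (cases "i < N") auto
      qed
      then show ?thesis by (rule finite_subset) simp
    qed
    \<comment> \<open>As the base is antitone, the pointwise maximum gives a set inside every
      \<open>U (\<beta> i)\<close>. The diagonal sequence misses it, although it is a neighbourhood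
      of the limit.\<close>
    define \<gamma> where "\<gamma> j = Max (range (\<lambda>i. \<beta> i j))" for j
    have "\<beta> i \<le> \<gamma>" for i
      unfolding le_fun_def \<gamma>_def using fin by (auto intro: Max_ge)
    then have "s (k i) (m i) \<notin> U \<gamma>" for i
      using anti \<beta>(2) by blast
    moreover obtain W where "openin X W" "x \<in> W" "W \<subseteq> U \<gamma>"
      using nhdU[of \<gamma>] by (auto simp: nhd_of_def)
    moreover from this have "\<forall>\<^sub>F i in sequentially. s (k i) (m i) \<in> W"
      using diag by (simp add: limitin_def)
    ultimately show False
      by (auto simp: eventually_sequentially)
  qed
  define \<B> where "\<B> = {N \<in> range D. nhd_of X x N}"
  have "countable \<B>"
    by (simp add: \<B>_def countable_Collect)
  moreover have "nhd_base_at X x \<B>"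
    unfolding nhd_base_at_def neighbourhood_base_at_def
  proof (intro conjI ballI allI impI)
    show "nhd_of X x N" if "N \<in> \<B>" for N
      using that by (simp add: \<B>_def)
    fix W assume "openin X W \<and> x \<in> W"
    then obtain \<alpha> where "U \<alpha> \<subseteq> W"
      using base unfolding nhd_base_at_def neighbourhood_base_at_def by blast
    then obtain k where "nhd_of X x (D (map \<alpha> [0..<k]))" "D (map \<alpha> [0..<k]) \<subseteq> W"
      using D_nhd D_sub by (meson order_trans)
    then show "\<exists>O' V. openin X O' \<and> V \<in> \<B> \<and> x \<in> O' \<and> O' \<subseteq> V \<and> V \<subseteq> W"
      unfolding \<B>_def nhd_of_def by blast
  qed
  ultimately show ?thesis by (rule that)
qed

subsection \<open>Uniform spaces given by a base of entourages\<close>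

text \<open>Symmetry and composition are demanded only up to passing to a smaller member, which is
  the form in which the coset relations have them. Members are relations on the carrier, so that
  their sections are subsets of the space.\<close>

locale uniform_base =
  fixes X :: "'b topology" and \<E> :: "'b rel set"
  assumes ex_entourage: "\<E> \<noteq> {}"
    and directed: "E \<in> \<E> \<Longrightarrow> F \<in> \<E> \<Longrightarrow> \<exists>D\<in>\<E>. D \<subseteq> E \<inter> F"
    and refl_entourage: "E \<in> \<E> \<Longrightarrow> x \<in> topspace X \<Longrightarrow> (x, x) \<in> E"
    and entourage_subset: "E \<in> \<E> \<Longrightarrow> E \<subseteq> topspace X \<times> topspace X"
    and converse_entourage: "E \<in> \<E> \<Longrightarrow> \<exists>D\<in>\<E>. D\<inverse> \<subseteq> E"
    and comp_entourage: "E \<in> \<E> \<Longrightarrow> \<exists>D\<in>\<E>. D O D \<subseteq> E"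
    and openin_iff: "openin X W \<longleftrightarrow> W \<subseteq> topspace X \<and> (\<forall>x\<in>W. \<exists>E\<in>\<E>. E `` {x} \<subseteq> W)"
    and separated: "x \<in> topspace X \<Longrightarrow> y \<in> topspace X \<Longrightarrow> (\<And>E. E \<in> \<E> \<Longrightarrow> (x, y) \<in> E) \<Longrightarrow> x = y"
begin

text \<open>The section \<open>E\<close>
  {x}\<open>need not be open. Its uniform interior\<close>W\<open>is: if\<close>D\<open>fits at\<close>y\<open>and\<close>D'
  O D' \<subseteq> D\<open>, then\<close>D'\<open>fits at every point of\<close>D'
  \<open>{y}\<close>.\<close>

lemma nhd_of_entourage:
  assumes "E \<in> \<E>" "x \<in> topspace X"
  shows "nhd_of X x (E `` {x})"
proof -
  define W where "W = {y \<in> topspace X. \<exists>D\<in>\<E>. D `` {y} \<subseteq> E `` {x}}"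
  have "openin X W"
    unfolding openin_iff
  proof (intro conjI ballI)
    fix y assume "y \<in> W"
    then obtain D where D: "D \<in> \<E>" "D `` {y} \<subseteq> E `` {x}"
      by (auto simp: W_def)
    then obtain D' where "D' \<in> \<E>" "D' O D' \<subseteq> D"
      using comp_entourage by blast
    with D have "D' `` {y} \<subseteq> W"
      using entourage_subset unfolding W_def by blast
    with \<open>D' \<in> \<E>\<close> show "\<exists>D'\<in>\<E>. D' `` {y} \<subseteq> W" by blast
  qed (auto simp: W_def)
  moreover have "x \<in> W"
    using assms by (auto simp: W_def)
  moreover have "W \<subseteq> E `` {x}"
    using refl_entourage unfolding W_def by blast
  moreover have "E `` {x} \<subseteq> topspace X"
    using assms entourage_subset by blast
  ultimately show ?thesis unfolding nhd_of_def by blast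
qed

lemma limitin_iff_entourage:
  "limitin X s x F \<longleftrightarrow> x \<in> topspace X \<and> (\<forall>E\<in>\<E>. \<forall>\<^sub>F i in F. (x, s i) \<in> E)"
proof (intro iffI conjI ballI)
  fix E assume lim: "limitin X s x F" and "E \<in> \<E>"
  then obtain W where "openin X W" "x \<in> W" and W: "W \<subseteq> E `` {x}"
    using nhd_of_entourage limitin_topspace unfolding nhd_of_def by metis
  then have "\<forall>\<^sub>F i in F. s i \<in> W"
    using lim by (simp add: limitin_def)
  then show "\<forall>\<^sub>F i in F. (x, s i) \<in> E"
    by (rule eventually_mono) (use W in auto)
next
  assume R: "x \<in> topspace X \<and> (\<forall>E\<in>\<E>. \<forall>\<^sub>F i in F. (x, s i) \<in> E)"
  show "limitin X s x F"
    unfolding limitin_def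
  proof (intro conjI allI impI)
    fix W assume "openin X W \<and> x \<in> W"
    then obtain E where "E \<in> \<E>" and E: "E `` {x} \<subseteq> W"
      using openin_iff by blast
    with R have "\<forall>\<^sub>F i in F. (x, s i) \<in> E" by blast
    then show "\<forall>\<^sub>F i in F. s i \<in> W"
      by (rule eventually_mono) (use E in auto)
  qed (use R in simp)
qed (simp add: limitin_topspace)

lemma metrizable_if_countable:
  fixes F :: "nat \<Rightarrow> 'b rel"
  assumes F: "\<And>n. F n \<in> \<E>" and small: "\<And>E. E \<in> \<E> \<Longrightarrow> \<exists>n. F n \<subseteq> E"
  shows "metrizable_space X"
proof -
  \<comment> \<open>Composition is halved twice; reflexivity gives \<open>D3 \<subseteq> D1\<close>,
    so the third factor can be counted as a factor \<open>D1\<close>.\<close>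
  have refine: "\<exists>D\<in>\<E>. D O D O D \<subseteq> E \<and> D \<subseteq> E'" if E: "E \<in> \<E>" "E' \<in> \<E>" for E E'
  proof -
    obtain D1 where D1: "D1 \<in> \<E>" "D1 O D1 \<subseteq> E"
      using E comp_entourage by blast
    obtain D2 where D2: "D2 \<in> \<E>" "D2 O D2 \<subseteq> D1"
      using D1 comp_entourage by blast
    obtain D3 where D3: "D3 \<in> \<E>" "D3 \<subseteq> D2 \<inter> E'"
      using D2 E directed by blast
    have "D3 \<subseteq> D1"
      using D3 D2 refl_entourage entourage_subset by blast
    with D2 D3 have "D3 O D3 O D3 \<subseteq> D1 O D1"
      by (intro relcomp_mono) blast+
    then have "D3 O D3 O D3 \<subseteq> E"
      using D1(2) by (rule order_trans)
    moreover have "D3 \<subseteq> E'" using D3(2) by blast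
    ultimately show ?thesis using D3(1) by meson
  qed
  have "\<exists>D. \<forall>n. (D n \<in> \<E> \<and> D n \<subseteq> F n) \<and> D (Suc n) O D (Suc n) O D (Suc n) \<subseteq> D n"
  proof (rule dependent_nat_choice)
    show "\<exists>D. D \<in> \<E> \<and> D \<subseteq> F 0" using F by blast
    show "\<exists>D'. (D' \<in> \<E> \<and> D' \<subseteq> F (Suc n)) \<and> D' O D' O D' \<subseteq> D" if "D \<in> \<E> \<and> D \<subseteq> F n" for D n
      using refine[of D "F (Suc n)"] that F by blast
  qed
  then obtain D where D: "\<And>n. D n \<in> \<E>" "\<And>n. D n \<subseteq> F n"
    "\<And>n. D (Suc n) O D (Suc n) O D (Suc n) \<subseteq> D n"
    by blast
  \<comment> \<open>\<open>chain_metric\<close> wants symmetric relations that are reflexive on the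
    whole type; \<open>Id\<close> supplies the pairs outside the carrier.\<close>
  define E where "E n = (D n \<inter> (D n)\<inverse>) \<union> Id" for n
  have D_refl: "(x, x) \<in> D n" if "x \<in> topspace X" for x n
    using D(1) refl_entourage that by blast
  have D_sub: "D n \<subseteq> topspace X \<times> topspace X" for n
    using D(1) entourage_subset by blast
  have E_comp: "E (Suc n) O E (Suc n) O E (Suc n) \<subseteq> E n" for n
  proof (rule subrelI)
    fix x u assume "(x, u) \<in> E (Suc n) O E (Suc n) O E (Suc n)"
    then obtain y z where yz: "(x, y) \<in> E (Suc n)" "(y, z) \<in> E (Suc n)" "(z, u) \<in> E (Suc n)"
      by blast
    show "(x, u) \<in> E n"
    \<comment> \<open>A chain with a nontrivial step lies entirely in the carrier, where identity
      steps are also steps of \<open>D (Suc n)\<close>. Applying \<open>D\<close> to the chain and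
      to its reverse gives both halves of \<open>E n\<close>.\<close>
    proof (cases "x = y \<and> y = z \<and> z = u")
      case False
      then have "x \<in> topspace X" "u \<in> topspace X" "y \<in> topspace X" "z \<in> topspace X"
        using yz D_sub by (auto simp: E_def)
      then have "{(x, y), (y, z), (z, u)} \<subseteq> D (Suc n)" "{(y, x), (z, y), (u, z)} \<subseteq> D (Suc n)"
        using yz D_refl by (auto simp: E_def)
      then have "(x, u) \<in> D (Suc n) O D (Suc n) O D (Suc n)" "(u, x) \<in> D (Suc n) O D (Suc n) O D (Suc n)"
        by blast+
      then have "(x, u) \<in> D n" "(u, x) \<in> D n"
        using D(3)[of n] by (meson subsetD)+
      then show ?thesis by (simp add: E_def)
    qed (simp add: E_def)
  qed
  have E_refl: "(x, x) \<in> E n" and E_sym: "(x, y) \<in> E n \<Longrightarrow> (y, x) \<in> E n" for x y n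
    by (auto simp: E_def)
  obtain d :: "'b \<Rightarrow> 'b \<Rightarrow> real" where d: "\<And>x y. 0 \<le> d x y" "\<And>x. d x x = 0" "\<And>x y. d x y = d y x"
    "\<And>x y z. d x z \<le> d x y + d y z"
    "\<And>n x y. (x, y) \<in> E n \<Longrightarrow> d x y < (1/2) ^ n"
    "\<And>n x y. d x y < (1/2) ^ Suc n \<Longrightarrow> (x, y) \<in> E n"
    by (rule chain_metric[of E, OF E_refl E_sym E_comp]) (assumption, (rule that; assumption))
  have below: "\<exists>n. E n \<inter> topspace X \<times> topspace X \<subseteq> E'" if "E' \<in> \<E>" for E'
  proof -
    obtain n where "F n \<subseteq> E'" using small \<open>E' \<in> \<E>\<close> by blast
    then have "E n \<inter> topspace X \<times> topspace X \<subseteq> E'"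
      using D(2)[of n] D_refl by (auto simp: E_def)
    then show ?thesis ..
  qed
  have above: "\<exists>E'\<in>\<E>. E' \<subseteq> E n" for n
  proof -
    obtain D' where D': "D' \<in> \<E>" "D'\<inverse> \<subseteq> D n"
      using D(1) converse_entourage by blast
    obtain D'' where "D'' \<in> \<E>" "D'' \<subseteq> D n \<inter> D'"
      using D(1) D'(1) directed by blast
    with D' have "D'' \<subseteq> E n" by (auto simp: E_def)
    with \<open>D'' \<in> \<E>\<close> show ?thesis ..
  qed
  interpret M: Metric_space "topspace X" d
  proof
    fix x y assume xy: "x \<in> topspace X" "y \<in> topspace X"
    show "d x y = 0 \<longleftrightarrow> x = y"
    proof
      assume 0: "d x y = 0"
      have "(x, y) \<in> E n" for n by (rule d(6)) (simp add: 0)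
      then show "x = y" using below separated xy by blast
    qed (simp add: d)
  qed (rule d)+
  have "openin M.mtopology W \<longleftrightarrow> openin X W" for W
    unfolding M.openin_mtopology openin_iff
  proof (rule conj_cong[OF refl], rule iffI)
    assume W: "\<forall>x. x \<in> W \<longrightarrow> (\<exists>r>0. M.mball x r \<subseteq> W)"
    show "\<forall>x\<in>W. \<exists>E\<in>\<E>. E `` {x} \<subseteq> W"
    proof
      fix x assume "x \<in> W"
      then obtain r where "r > 0" "M.mball x r \<subseteq> W" using W by blast
      moreover from \<open>r > 0\<close> obtain n where n: "(1/2) ^ n < r"
        using real_arch_pow_inv[of r "1/2"] by auto
      moreover obtain E' where E': "E' \<in> \<E>" "E' \<subseteq> E n" using above by blast
      have "E' `` {x} \<subseteq> M.mball x r"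
      proof
        fix y assume "y \<in> E' `` {x}"
        then have "(x, y) \<in> E n" "x \<in> topspace X" "y \<in> topspace X"
          using E' entourage_subset by blast+
        then show "y \<in> M.mball x r"
          using d(5)[of x y n] n by simp
      qed
      ultimately show "\<exists>E\<in>\<E>. E `` {x} \<subseteq> W" using E' by blast
    qed
  next
    assume W: "\<forall>x\<in>W. \<exists>E\<in>\<E>. E `` {x} \<subseteq> W"
    show "\<forall>x. x \<in> W \<longrightarrow> (\<exists>r>0. M.mball x r \<subseteq> W)"
    proof (intro allI impI)
      fix x assume "x \<in> W"
      then obtain E' where E': "E' \<in> \<E>" "E' `` {x} \<subseteq> W" using W by blast
      then obtain n where "E n \<inter> topspace X \<times> topspace X \<subseteq> E'" using below by blast
      with E' have "M.mball x ((1/2) ^ Suc n) \<subseteq> W"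
        using d(6) by (fastforce simp del: power_Suc)
      then show "\<exists>r>0. M.mball x r \<subseteq> W"
        by (intro exI[of _ "(1/2) ^ Suc n"]) simp
    qed
  qed
  then have "X = M.mtopology" by (simp add: topology_eq)
  then show ?thesis using M.metrizable_space_mtopology by simp
qed

end

section \<open>Homogeneous uniform spaces\<close>

locale homogeneous_uniform_base = uniform_base X \<E>
  for X :: "'b topology" and \<E> :: "'b rel set" +
  assumes homogeneous: "x \<in> topspace X \<Longrightarrow> y \<in> topspace X \<Longrightarrow>
    \<exists>f. f \<in> topspace X \<rightarrow> topspace X \<and> f x = y \<and>
      (\<forall>E\<in>\<E>. \<forall>u\<in>topspace X. \<forall>v\<in>topspace X. (f u, f v) \<in> E \<longleftrightarrow> (u, v) \<in> E)"
begin

text \<open>A common point \<open>z\<close> of the two sections would link \<open>x\<close> to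
  \<open>y\<close> inside \<open>C O C \<subseteq> D\<close>, where \<open>D\<close> is an entourage
  separating them.\<close>

lemma disjoint_entourage:
  assumes "x \<in> topspace X" "y \<in> topspace X" "x \<noteq> y"
  obtains E where "E \<in> \<E>" "\<And>z. (y, z) \<in> E \<Longrightarrow> (x, z) \<notin> E"
proof -
  obtain D where D: "D \<in> \<E>" "(x, y) \<notin> D"
    using assms separated by blast
  obtain C where C: "C \<in> \<E>" "C O C \<subseteq> D"
    using D comp_entourage by blast
  obtain B where B: "B \<in> \<E>" "B\<inverse> \<subseteq> C"
    using C converse_entourage by blast
  obtain E where E: "E \<in> \<E>" "E \<subseteq> B \<inter> C"
    using B C directed by blast
  have "(x, z) \<notin> E" if "(y, z) \<in> E" for z
  proof
    assume "(x, z) \<in> E"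
    then have "(x, z) \<in> C" "(z, y) \<in> C"
      using E(2) B(2) that by auto
    then show False using C(2) D(2) by auto
  qed
  with E(1) show ?thesis by (rule that)
qed

text \<open>Nyikos' argument: move the \<open>n\<close>-th sequence so that it converges to \<open>a n \<noteq> p\<close>, choose a
  sequence converging to \<open>p\<close> among the moved points, and move back.\<close>

lemma diagonal_sequence:
  fixes s :: "nat \<Rightarrow> nat \<Rightarrow> 'b"
  assumes fu: "frechet_urysohn_space X"
    and p: "p \<in> topspace X"
    and s: "\<And>k m. s k m \<in> topspace X - {p}"
    and lim: "\<And>k. limitin X (s k) p sequentially"
  shows "\<exists>k m. filterlim k at_top sequentially \<and> limitin X (\<lambda>i. s (k i) (m i)) p sequentially"
proof -
  \<comment> \<open>Only a sequence of points other than \<open>p\<close> that converges to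
    \<open>p\<close> is wanted here, and the first of the given ones is such a sequence.\<close>
  define a where "a = s 0"
  have a: "a n \<in> topspace X" "p \<noteq> a n" for n
    using s[of 0 n] by (auto simp: a_def)
  have "\<forall>n. \<exists>E. E \<in> \<E> \<and> (\<forall>z. (a n, z) \<in> E \<longrightarrow> (p, z) \<notin> E)"
    using disjoint_entourage[OF p a(1) a(2)] by metis
  then obtain E where E: "\<And>n. E n \<in> \<E>" "\<And>n z. (a n, z) \<in> E n \<Longrightarrow> (p, z) \<notin> E n"
    by metis
  have "\<forall>n. \<exists>f. f \<in> topspace X \<rightarrow> topspace X \<and> f p = a n \<and>
      (\<forall>E\<in>\<E>. \<forall>u\<in>topspace X. \<forall>v\<in>topspace X. (f u, f v) \<in> E \<longleftrightarrow> (u, v) \<in> E)"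
    using homogeneous p a(1) by blast
  then obtain f where f: "\<And>n. f n \<in> topspace X \<rightarrow> topspace X" "\<And>n. f n p = a n"
    and f_inv: "\<And>n E u v. E \<in> \<E> \<Longrightarrow> u \<in> topspace X \<Longrightarrow> v \<in> topspace X \<Longrightarrow>
      (f n u, f n v) \<in> E \<longleftrightarrow> (u, v) \<in> E"
    by metis
  have f_near: "(a n, f n (s n m)) \<in> D \<longleftrightarrow> (p, s n m) \<in> D" if "D \<in> \<E>" for n m D
    using f_inv[OF that p, of "s n m" n] s[of n m] f(2)[of n] by simp
  \<comment> \<open>The condition with \<open>E n\<close> keeps the moved points of index
    \<open>n\<close> out of the section of \<open>E n\<close> at \<open>p\<close>. A sequence in
    \<open>A\<close> that tends to \<open>p\<close> therefore leaves every finite set of indices,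
    which makes \<open>k\<close> tend to infinity.\<close>
  define A where "A = {f n (s n m) | n m. (a n, f n (s n m)) \<in> E n}"
  have "A \<subseteq> topspace X"
    using f(1) s unfolding A_def by blast
  \<comment> \<open>For each \<open>n\<close> the moved sequence tends to \<open>a n\<close>, so
    every \<open>a n\<close> is a limit of points of \<open>A\<close>; and \<open>a\<close> tends to
    \<open>p\<close>.\<close>
  moreover have "p \<in> X closure_of A"
    unfolding in_closure_of
  proof (intro conjI p allI impI, elim conjE)
    fix W assume W: "p \<in> W" "openin X W"
    then have "\<forall>\<^sub>F n in sequentially. a n \<in> W"
      using lim[of 0] by (simp add: a_def limitin_def)
    then obtain n where "a n \<in> W"
      by (auto simp: eventually_sequentially)
    then obtain D where D: "D \<in> \<E>" "D `` {a n} \<subseteq> W"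
      using W openin_iff by blast
    have "\<forall>\<^sub>F m in sequentially. (p, s n m) \<in> D \<and> (p, s n m) \<in> E n"
      using lim[of n] D(1) E(1) by (auto simp: limitin_iff_entourage intro: eventually_conj)
    then obtain m where "(p, s n m) \<in> D" "(p, s n m) \<in> E n"
      by (auto simp: eventually_sequentially)
    then have "f n (s n m) \<in> A" "f n (s n m) \<in> W"
      using f_near[OF D(1)] f_near[OF E(1)] D(2) unfolding A_def by auto
    then show "\<exists>y. y \<in> A \<and> y \<in> W" by blast
  qed
  ultimately obtain z where z: "\<And>i. z i \<in> A" and z_lim: "limitin X z p sequentially"
    using fu unfolding frechet_urysohn_space_def by metis
  have "\<forall>i. \<exists>n m. z i = f n (s n m) \<and> (a n, z i) \<in> E n"
  proof
    fix i
    obtain n m where "z i = f n (s n m)" "(a n, f n (s n m)) \<in> E n"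
      using z[of i] unfolding A_def by blast
    then show "\<exists>n m. z i = f n (s n m) \<and> (a n, z i) \<in> E n" by auto
  qed
  then obtain k m where km: "\<And>i. z i = f (k i) (s (k i) (m i))" "\<And>i. (a (k i), z i) \<in> E (k i)"
    by metis
  have z_near: "\<forall>\<^sub>F i in sequentially. (p, z i) \<in> D" if "D \<in> \<E>" for D
    using z_lim that by (simp add: limitin_iff_entourage)
  have k: "filterlim k at_top sequentially"
    unfolding filterlim_at_top
  proof
    fix N
    have "\<forall>\<^sub>F i in sequentially. \<forall>n\<in>{..<N}. (p, z i) \<in> E n"
      by (rule eventually_ball_finite) (auto intro: z_near E(1))
    then show "\<forall>\<^sub>F i in sequentially. N \<le> k i"
      by (rule eventually_mono) (use E(2) km(2) in \<open>meson lessThan_iff not_le\<close>)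
  qed
  \<comment> \<open>As \<open>k\<close> tends to infinity, \<open>a (k i)\<close> tends to
    \<open>p\<close> and can replace \<open>p\<close> as the point from which \<open>z i\<close> is
    seen. The map \<open>f (k i)\<close> is then undone by \<open>f_near\<close>; this is uniform in
    \<open>i\<close> because every \<open>f n\<close> preserves the same \<open>D\<close>.\<close>
  moreover have "limitin X (\<lambda>i. s (k i) (m i)) p sequentially"
    unfolding limitin_iff_entourage
  proof (intro conjI p ballI)
    fix D assume D: "D \<in> \<E>"
    obtain C where C: "C \<in> \<E>" "C O C \<subseteq> D"
      using D comp_entourage by blast
    obtain B where B: "B \<in> \<E>" "B\<inverse> \<subseteq> C"
      using C converse_entourage by blast
    have "\<forall>\<^sub>F n in sequentially. (p, a n) \<in> B"
      using lim[of 0] B(1) by (simp add: a_def limitin_iff_entourage)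
    then have "\<forall>\<^sub>F i in sequentially. (p, a (k i)) \<in> B"
      using k by (rule eventually_compose_filterlim)
    then show "\<forall>\<^sub>F i in sequentially. (p, s (k i) (m i)) \<in> D"
      using z_near[OF C(1)]
    proof eventually_elim
      case (elim i)
      then have "(a (k i), z i) \<in> D" using B(2) C(2) by auto
      then show ?case using f_near[OF D] km(1) by simp
    qed
  qed
  ultimately show ?thesis by blast
qed

text \<open>A countable base at the single point \<open>p\<close> yields a countable base of the
  uniformity: choose for each \<open>N\<close> an entourage whose section at \<open>p\<close> fits
  into \<open>N\<close>. By invariance, an inclusion of sections at \<open>p\<close> holds at every
  point.\<close>

lemma metrizable_if_frechet_urysohn:
  assumes fu: "frechet_urysohn_space X" and base: "has_omega_omega_base X"
    and p: "p \<in> topspace X"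
  shows "metrizable_space X"
proof -
  obtain U :: "(nat \<Rightarrow> nat) \<Rightarrow> 'b set" where
    "nhd_base_at X p (range U)" "\<And>\<alpha> \<beta>. \<alpha> \<le> \<beta> \<Longrightarrow> U \<beta> \<subseteq> U \<alpha>"
    using base p unfolding has_omega_omega_base_def by metis
  then obtain \<B> where \<B>: "countable \<B>" "nhd_base_at X p \<B>"
    by (rule countable_nhd_base_if_diagonal[OF fu p _ _ diagonal_sequence[OF fu p]])
  have "\<exists>E. E \<in> \<E> \<and> E `` {p} \<subseteq> N" if N: "N \<in> \<B>" for N
  proof -
    obtain W where "openin X W" "p \<in> W" "W \<subseteq> N"
      using N \<B>(2) unfolding nhd_base_at_def nhd_of_def by blast
    then show ?thesis using openin_iff[of W] by blast
  qed
  then obtain e where e: "\<And>N. N \<in> \<B> \<Longrightarrow> e N \<in> \<E> \<and> e N `` {p} \<subseteq> N"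
    by metis
  have fine: "\<exists>N\<in>\<B>. e N \<subseteq> E" if E: "E \<in> \<E>" for E
  proof -
    obtain W where "openin X W" "p \<in> W" "W \<subseteq> E `` {p}"
      using nhd_of_entourage[OF E p] unfolding nhd_of_def by blast
    then obtain N where N: "N \<in> \<B>" "N \<subseteq> E `` {p}"
      using \<B>(2) unfolding nhd_base_at_def neighbourhood_base_at_def by (meson order_trans)
    \<comment> \<open>With \<open>x\<close> moved to \<open>p\<close>, one direction of the
      invariance carries \<open>e N\<close> along, and the other pulls \<open>E\<close>
      back.\<close>
    have "(x, y) \<in> E" if xy: "(x, y) \<in> e N" for x y
    proof -
      have top: "x \<in> topspace X" "y \<in> topspace X"
        using xy e[OF N(1)] entourage_subset by blast+
      then obtain f where f: "f x = p"
        "\<forall>E\<in>\<E>. \<forall>u\<in>topspace X. \<forall>v\<in>topspace X. (f u, f v) \<in> E \<longleftrightarrow> (u, v) \<in> E"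
        using homogeneous p by metis
      then have "(p, f y) \<in> e N" using xy top e[OF N(1)] by metis
      then have "(p, f y) \<in> E" using e[OF N(1)] N(2) by blast
      then show ?thesis using f top E by metis
    qed
    then have "e N \<subseteq> E" by (rule subrelI)
    then show ?thesis using N(1) ..
  qed
  have "\<B> \<noteq> {}" using fine ex_entourage by blast
  then have from_nat: "range (from_nat_into \<B>) = \<B>"
    using \<B>(1) by (rule range_from_nat_into)
  show ?thesis
  proof (rule metrizable_if_countable)
    show "e (from_nat_into \<B> n) \<in> \<E>" for n
      using e from_nat by blast
    show "\<exists>n. e (from_nat_into \<B> n) \<subseteq> E" if "E \<in> \<E>" for E
      using fine[OF that] from_nat by (metis imageE)
  qed
qed

end

subsection \<open>Products of subsets\<close>

lemma set_oplus_mono: "A \<subseteq> A' \<Longrightarrow> B \<subseteq> B' \<Longrightarrow> set_oplus f A B \<subseteq> set_oplus f A' B'"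
  by (auto simp: set_oplus_def)

lemma set_oplusI: "a \<in> A \<Longrightarrow> b \<in> B \<Longrightarrow> f a b \<in> set_oplus f A B"
  by (auto simp: set_oplus_def)

lemma set_oplusE:
  assumes "c \<in> set_oplus f A B"
  obtains a b where "a \<in> A" "b \<in> B" "c = f a b"
  using assms by (auto simp: set_oplus_def)

lemma set_oplus_singleton: "set_oplus f {a} {b} = {f a b}"
  by (auto simp: set_oplus_def)

text \<open>In this form cosets are subject to the associativity of set products.\<close>

lemma left_coset_eq: "left_coset f H a = set_oplus f {a} H"
  by (auto simp: set_oplus_def left_coset_def)

subsection \<open>Gyrogroup algebra\<close>

context gyrogroup
begin

abbreviation zero :: 'a  ("\<zero>") where "\<zero> \<equiv> gyro_zero G oplus"
abbreviation neg :: "'a \<Rightarrow> 'a"  ("\<ominus> _" [81] 80) where "\<ominus> x \<equiv> gyro_inv G oplus x"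
abbreviation set_prod :: "'a set \<Rightarrow> 'a set \<Rightarrow> 'a set"  (infixl "\<odot>" 65)
  where "A \<odot> B \<equiv> set_oplus oplus A B"

lemma zero: "\<zero> \<in> G" and zero_left [simp]: "a \<in> G \<Longrightarrow> \<zero> \<oplus> a = a"
  and zero_right [simp]: "a \<in> G \<Longrightarrow> a \<oplus> \<zero> = a"
  using theI'[OF G1] unfolding gyro_zero_def[symmetric] by auto

lemma neg:
  assumes "x \<in> G"
  shows "\<ominus> x \<in> G" and "\<ominus> x \<oplus> x = \<zero>" and "x \<oplus> \<ominus> x = \<zero>"
  using theI'[OF G2[OF assms]] unfolding gyro_inv_def[symmetric] by auto

lemma neg_neg: "x \<in> G \<Longrightarrow> \<ominus> (\<ominus> x) = x"
  using G2[of "\<ominus> x"] neg[of x] neg[of "\<ominus> x"] by auto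

lemma gyr_bij: "x \<in> G \<Longrightarrow> y \<in> G \<Longrightarrow> bij_betw (gyr x y) G G"
  and gyr_oplus: "x \<in> G \<Longrightarrow> y \<in> G \<Longrightarrow> a \<in> G \<Longrightarrow> b \<in> G \<Longrightarrow>
    gyr x y (a \<oplus> b) = gyr x y a \<oplus> gyr x y b"
  using G3_aut[of x y] by (auto simp: gyro_aut_def)

lemma gyr_closed: "x \<in> G \<Longrightarrow> y \<in> G \<Longrightarrow> a \<in> G \<Longrightarrow> gyr x y a \<in> G"
  using gyr_bij[of x y] bij_betwE by blast

lemma gyr_inject: "x \<in> G \<Longrightarrow> y \<in> G \<Longrightarrow> a \<in> G \<Longrightarrow> b \<in> G \<Longrightarrow> gyr x y a = gyr x y b \<Longrightarrow> a = b"
  using gyr_bij[of x y] by (auto simp: bij_betw_def inj_on_def)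

lemma neg_oplus_gyr:
  assumes "a \<in> G" "b \<in> G"
  shows "\<ominus> a \<oplus> (a \<oplus> b) = gyr (\<ominus> a) a b"
  using assms neg[of a] G3[of "\<ominus> a" a b] gyr_closed[of "\<ominus> a" a b] by simp

lemma oplus_left_cancel:
  assumes "a \<in> G" "b \<in> G" "c \<in> G" "a \<oplus> b = a \<oplus> c"
  shows "b = c"
  using assms neg_oplus_gyr[of a b] neg_oplus_gyr[of a c] gyr_inject[of "\<ominus> a" a b c] neg[of a] by simp

text \<open>G4 identifies \<open>gyr (\<ominus> a) a\<close> with \<open>gyr \<zero> a\<close>,
  which is the identity by G3 and left cancellation.\<close>

lemma neg_oplus_cancel:
  assumes "a \<in> G" "b \<in> G"
  shows "\<ominus> a \<oplus> (a \<oplus> b) = b"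
proof -
  have "a \<oplus> b = a \<oplus> gyr \<zero> a b"
    using G3[of \<zero> a b] assms zero closed[of a b] by simp
  then have "gyr \<zero> a b = b"
    using oplus_left_cancel[of a b "gyr \<zero> a b"] assms zero gyr_closed[of \<zero> a b] by simp
  moreover have "gyr \<zero> a b = gyr (\<ominus> a) a b"
    using G4[of "\<ominus> a" a b] assms neg[of a] by simp
  ultimately show ?thesis using neg_oplus_gyr assms by simp
qed

lemma oplus_neg_cancel:
  assumes "a \<in> G" "b \<in> G"
  shows "a \<oplus> (\<ominus> a \<oplus> b) = b"
  using neg_oplus_cancel[of "\<ominus> a" b] assms neg(1) neg_neg by simp

lemma neg_unique:
  assumes "a \<in> G" "b \<in> G" "a \<oplus> b = \<zero>"
  shows "b = \<ominus> a"
  using neg_oplus_cancel[OF assms(1,2)] assms neg(1)[of a] by simp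

lemma gyr_zero: "x \<in> G \<Longrightarrow> y \<in> G \<Longrightarrow> gyr x y \<zero> = \<zero>"
  using gyr_oplus[of x y \<zero> \<zero>] zero gyr_closed[of x y \<zero>]
    oplus_left_cancel[of "gyr x y \<zero>" "gyr x y \<zero>" \<zero>] by simp

text \<open>A form of the gyrosum inversion law: G3 and left cancellation show that the gyration of
  \<open>a \<oplus> b\<close> is a right inverse of \<open>\<ominus> b \<oplus> \<ominus> a\<close>.
  A gyration-stable set does not see the remaining gyration.\<close>

lemma gyr_neg_oplus:
  assumes "a \<in> G" "b \<in> G"
  shows "gyr (\<ominus> b) (\<ominus> a) (\<ominus> (a \<oplus> b)) = \<ominus> b \<oplus> \<ominus> a"
proof -
  let ?g = "gyr (\<ominus> b) (\<ominus> a)"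
  have G: "\<ominus> a \<in> G" "\<ominus> b \<in> G" "a \<oplus> b \<in> G" "\<ominus> (a \<oplus> b) \<in> G" "\<ominus> b \<oplus> \<ominus> a \<in> G"
    using assms neg closed by auto
  then have gG: "?g (a \<oplus> b) \<in> G" "?g (\<ominus> (a \<oplus> b)) \<in> G"
    using gyr_closed by auto
  have "(\<ominus> b \<oplus> \<ominus> a) \<oplus> ?g (a \<oplus> b) = \<ominus> b \<oplus> (\<ominus> a \<oplus> (a \<oplus> b))"
    using G3 G by simp
  also have "\<dots> = \<zero>" using assms neg_oplus_cancel neg by simp
  finally have "?g (a \<oplus> b) = \<ominus> (\<ominus> b \<oplus> \<ominus> a)"
    using neg_unique G gG by blast
  moreover have "?g (a \<oplus> b) \<oplus> ?g (\<ominus> (a \<oplus> b)) = \<zero>"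
    using gyr_oplus[of "\<ominus> b" "\<ominus> a" "a \<oplus> b" "\<ominus> (a \<oplus> b)"] G neg(3)[of "a \<oplus> b"] gyr_zero by simp
  then have "?g (\<ominus> (a \<oplus> b)) = \<ominus> ?g (a \<oplus> b)"
    using neg_unique gG by blast
  ultimately show ?thesis using neg_neg G by simp
qed

section \<open>Gyration-stable sets\<close>

definition gyr_stable :: "'a set \<Rightarrow> bool" where
  "gyr_stable A \<longleftrightarrow> A \<subseteq> G \<and> (\<forall>x\<in>G. \<forall>y\<in>G. gyr x y ` A = A)"

lemma gyr_stable_subset: "gyr_stable A \<Longrightarrow> A \<subseteq> G"
  by (simp add: gyr_stable_def)

lemma set_oplus_closed: "A \<subseteq> G \<Longrightarrow> B \<subseteq> G \<Longrightarrow> A \<odot> B \<subseteq> G"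
  using closed by (auto simp: set_oplus_def)

text \<open>Stability of the last factor absorbs the gyration, so that products of stable sets can be
  handled as in a group.\<close>

lemma set_oplus_assoc:
  assumes "A \<subseteq> G" "B \<subseteq> G" "gyr_stable C"
  shows "(A \<odot> B) \<odot> C = A \<odot> (B \<odot> C)"
proof -
  have C: "C \<subseteq> G" "\<And>x y. x \<in> G \<Longrightarrow> y \<in> G \<Longrightarrow> gyr x y ` C = C"
    using assms(3) by (auto simp: gyr_stable_def)
  show ?thesis
  proof (intro equalityI subsetI)
    fix z assume "z \<in> (A \<odot> B) \<odot> C"
    then obtain a b c where abc: "a \<in> A" "b \<in> B" "c \<in> C" "z = (a \<oplus> b) \<oplus> c"
      by (auto elim!: set_oplusE)
    then have G: "a \<in> G" "b \<in> G" using assms by auto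
    \<comment> \<open>Here stability is needed as an equality: \<open>c\<close> has to be the
      gyration of an element of \<open>C\<close>.\<close>
    then obtain c' where "c' \<in> C" "c = gyr a b c'"
      using C(2)[of a b] abc(3) by blast
    then have "z = a \<oplus> (b \<oplus> c')" using abc G C(1) G3[of a b c'] by auto
    then show "z \<in> A \<odot> (B \<odot> C)" using abc \<open>c' \<in> C\<close> by (auto intro: set_oplusI)
  next
    fix z assume "z \<in> A \<odot> (B \<odot> C)"
    then obtain a b c where abc: "a \<in> A" "b \<in> B" "c \<in> C" "z = a \<oplus> (b \<oplus> c)"
      by (auto elim!: set_oplusE)
    then have "z = (a \<oplus> b) \<oplus> gyr a b c" "gyr a b c \<in> C"
      using assms(1,2) C G3[of a b c] by blast+
    then show "z \<in> (A \<odot> B) \<odot> C" using abc by (auto intro: set_oplusI)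
  qed
qed

lemma gyr_stable_set_oplus:
  assumes "gyr_stable A" "gyr_stable B"
  shows "gyr_stable (A \<odot> B)"
  unfolding gyr_stable_def
proof (intro conjI ballI)
  have sub: "A \<subseteq> G" "B \<subseteq> G" using assms by (simp_all add: gyr_stable_def)
  then show "A \<odot> B \<subseteq> G" by (rule set_oplus_closed)
  fix x y assume xy: "x \<in> G" "y \<in> G"
  have "gyr x y ` (A \<odot> B) = (gyr x y ` A) \<odot> (gyr x y ` B)"
  proof (intro equalityI subsetI)
    fix z assume "z \<in> gyr x y ` (A \<odot> B)"
    then obtain a b where ab: "a \<in> A" "b \<in> B" "z = gyr x y (a \<oplus> b)"
      by (auto elim!: set_oplusE)
    then have "z = gyr x y a \<oplus> gyr x y b"
      using gyr_oplus[OF xy, of a b] sub by auto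
    then show "z \<in> (gyr x y ` A) \<odot> (gyr x y ` B)" using ab(1,2) by (simp only: set_oplusI imageI)
  next
    fix z assume "z \<in> (gyr x y ` A) \<odot> (gyr x y ` B)"
    then obtain a b where ab: "a \<in> A" "b \<in> B" "z = gyr x y a \<oplus> gyr x y b"
      by (auto elim!: set_oplusE)
    then have "a \<in> G" "b \<in> G" using sub by auto
    then have "z = gyr x y (a \<oplus> b)"
      using gyr_oplus[OF xy, of a b] ab(3) by simp
    then show "z \<in> gyr x y ` (A \<odot> B)" using ab(1,2) by (simp only: set_oplusI imageI)
  qed
  then show "gyr x y ` (A \<odot> B) = A \<odot> B"
    using assms xy by (simp add: gyr_stable_def)
qed

end

subsection \<open>The left-invariant uniformity of the coset space\<close>

locale neutral_quotient = strongly_topological_gyrogroup T oplus gyr \<U>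
  for T :: "'a topology"
    and oplus :: "'a \<Rightarrow> 'a \<Rightarrow> 'a"  (infixl \<open>\<oplus>\<close> 65)
    and gyr :: "'a \<Rightarrow> 'a \<Rightarrow> 'a \<Rightarrow> 'a"
    and \<U> :: "'a set set" +
  fixes H :: "'a set"
  assumes symmetric: "U \<in> \<U> \<Longrightarrow> symmetric_in (topspace T) oplus U"
    and generated: "generated_from T oplus H \<U>"
    and neutral: "neutral_subgyrogroup T oplus gyr H"
begin

notation zero ("\<zero>") and neg ("\<ominus> _" [81] 80) and set_prod (infixl "\<odot>" 65)

abbreviation G where "G \<equiv> topspace T"

abbreviation \<pi> :: "'a \<Rightarrow> 'a set" where "\<pi> \<equiv> left_coset oplus H"

lemma base_subset: "U \<in> \<U> \<Longrightarrow> U \<subseteq> G" and base_zero: "U \<in> \<U> \<Longrightarrow> \<zero> \<in> U"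
  using nhd_base by (auto simp: nhd_base_at_def nhd_of_def)

lemma base_neg: "U \<in> \<U> \<Longrightarrow> x \<in> U \<Longrightarrow> \<ominus> x \<in> U"
  using symmetric[of U] unfolding symmetric_in_def by blast

lemma base_stable: "U \<in> \<U> \<Longrightarrow> gyr_stable U"
  using base_subset gyr_invariant by (auto simp: gyr_stable_def)

lemma base_interior:
  assumes "U \<in> \<U>"
  obtains V where "openin T V" "\<zero> \<in> V" "V \<subseteq> U"
  using assms nhd_base by (auto simp: nhd_base_at_def nhd_of_def)

lemma base_below:
  assumes "openin T V" "\<zero> \<in> V"
  obtains U where "U \<in> \<U>" "U \<subseteq> V"
  using assms nhd_base unfolding nhd_base_at_def neighbourhood_base_at_def by blast

lemma base_directed:
  assumes "U \<in> \<U>" "V \<in> \<U>"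
  obtains W where "W \<in> \<U>" "W \<subseteq> U" "W \<subseteq> V"
proof -
  obtain U' V' where U': "openin T U'" "\<zero> \<in> U'" "U' \<subseteq> U" and V': "openin T V'" "\<zero> \<in> V'" "V' \<subseteq> V"
    using assms base_interior by metis
  then have "openin T (U' \<inter> V')" "\<zero> \<in> U' \<inter> V'" by auto
  then obtain W where "W \<in> \<U>" "W \<subseteq> U' \<inter> V'"
    by (rule base_below)
  then show ?thesis using U' V' by (intro that[of W]) auto
qed

text \<open>An L-subgyrogroup is invariant under \<open>gyr a h\<close> with \<open>h\<close> in
  \<open>H\<close> only. Stability under all gyrations comes from the generating sequence, as
  injective maps commute with intersections of stable sets.\<close>

lemma H_subset: "H \<subseteq> G" and H_zero: "\<zero> \<in> H" and H_neg: "x \<in> H \<Longrightarrow> \<ominus> x \<in> H"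
  and H_stable: "gyr_stable H"
  and H_Inter: "\<exists>U. (\<forall>n. U n \<in> \<U>) \<and> (\<forall>n. U (Suc n) \<odot> (U (Suc n) \<odot> U (Suc n)) \<subseteq> U n) \<and> H = (\<Inter>n. U n)"
proof -
  obtain U where U: "\<And>n. U n \<in> \<U>" and H: "H = (\<Inter>n. U n)"
    and U_Suc: "\<And>n. U (Suc n) \<odot> (U (Suc n) \<odot> U (Suc n)) \<subseteq> U n"
    using generated unfolding generated_from_def admissible_sequence_def by blast
  then show "\<exists>U. (\<forall>n. U n \<in> \<U>) \<and> (\<forall>n. U (Suc n) \<odot> (U (Suc n) \<odot> U (Suc n)) \<subseteq> U n) \<and> H = (\<Inter>n. U n)"
    by blast
  show sub: "H \<subseteq> G" using U base_subset H by blast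
  show "\<zero> \<in> H" using U base_zero H by blast
  show "\<ominus> x \<in> H" if "x \<in> H" using that U base_neg H by blast
  show "gyr_stable H"
    unfolding gyr_stable_def
  proof (intro conjI sub ballI)
    fix x y assume xy: "x \<in> G" "y \<in> G"
    have "inj_on (gyr x y) G" using gyr_bij[OF xy] by (simp add: bij_betw_def)
    then have "gyr x y ` (\<Inter>n. U n) = (\<Inter>n. gyr x y ` U n)"
      using U base_subset by (intro image_INT[of _ G _ _ 0]) auto
    then show "gyr x y ` H = H" using U gyr_invariant xy H by simp
  qed
qed

lemma H_oplus_subset: "H \<odot> H \<subseteq> H"
  using neutral unfolding neutral_subgyrogroup_def L_subgyrogroup_def subgyrogroup_def
  by (auto elim!: set_oplusE)

lemma H_oplus: "H \<odot> H = H"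
proof
  show "H \<subseteq> H \<odot> H"
  proof
    fix h assume "h \<in> H"
    then have "\<zero> \<oplus> h \<in> H \<odot> H" "\<zero> \<oplus> h = h"
      using H_zero H_subset by (auto intro: set_oplusI)
    then show "h \<in> H \<odot> H" by simp
  qed
qed (rule H_oplus_subset)

lemma singleton_oplus_H:
  assumes "h \<in> H"
  shows "{h} \<odot> H = H"
proof
  show "{h} \<odot> H \<subseteq> H"
    using set_oplus_mono[of "{h}" H H H oplus] assms H_oplus_subset by blast
  show "H \<subseteq> {h} \<odot> H"
  proof
    fix x assume x: "x \<in> H"
    then have "\<ominus> h \<oplus> x \<in> H"
      using H_neg[OF assms] by (intro subsetD[OF H_oplus_subset, OF set_oplusI])
    then have "h \<oplus> (\<ominus> h \<oplus> x) \<in> {h} \<odot> H" by (simp add: set_oplusI)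
    then show "x \<in> {h} \<odot> H"
      using oplus_neg_cancel[of h x] subsetD[OF H_subset x] subsetD[OF H_subset assms] by simp
  qed
qed

lemma coset_eq_iff:
  assumes "a \<in> G" "b \<in> G"
  shows "\<pi> a = \<pi> b \<longleftrightarrow> b \<in> {a} \<odot> H"
proof
  assume "\<pi> a = \<pi> b"
  moreover have "b \<oplus> \<zero> \<in> \<pi> b" using H_zero by (simp add: left_coset_def)
  ultimately show "b \<in> {a} \<odot> H" using assms by (simp add: left_coset_eq)
next
  assume "b \<in> {a} \<odot> H"
  then obtain h where h: "h \<in> H" "b = a \<oplus> h" by (auto elim!: set_oplusE)
  then have "\<pi> b = ({a} \<odot> {h}) \<odot> H"
    by (simp add: left_coset_eq set_oplus_singleton)
  also have "\<dots> = {a} \<odot> ({h} \<odot> H)"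
    using assms h H_subset H_stable by (intro set_oplus_assoc) auto
  finally show "\<pi> a = \<pi> b"
    using singleton_oplus_H[OF h(1)] by (simp add: left_coset_eq)
qed

section \<open>The sets \<open>W \<odot> H\<close> and neutrality\<close>

lemma nbhd_stable: "W \<in> \<U> \<Longrightarrow> gyr_stable (W \<odot> H)"
  by (intro gyr_stable_set_oplus base_stable H_stable)

lemma nbhd_oplus_H: "W \<subseteq> G \<Longrightarrow> (W \<odot> H) \<odot> H = W \<odot> H"
  using set_oplus_assoc[of W H H] H_subset H_stable H_oplus by simp

lemma base_neutral:
  assumes "W \<in> \<U>"
  obtains V where "V \<in> \<U>" "V \<subseteq> W" "H \<odot> V \<subseteq> W \<odot> H"
proof -
  obtain U where U: "openin T U" "\<zero> \<in> U" "U \<subseteq> W"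
    using assms base_interior by metis
  then obtain V' where V': "openin T V'" "\<zero> \<in> V'" "H \<odot> V' \<subseteq> U \<odot> H"
    using neutral unfolding neutral_subgyrogroup_def by blast
  then obtain V1 where "V1 \<in> \<U>" "V1 \<subseteq> V'" using base_below by metis
  then obtain V where V: "V \<in> \<U>" "V \<subseteq> W" "V \<subseteq> V'"
    using base_directed[OF assms] by (metis order_trans)
  have "H \<odot> V \<subseteq> H \<odot> V'" "U \<odot> H \<subseteq> W \<odot> H"
    using V U by (simp_all add: set_oplus_mono)
  with V' V show ?thesis by (intro that[of V]) auto
qed

lemma H_oplus_nbhd:
  assumes "V \<subseteq> G" "W \<subseteq> G" "H \<odot> V \<subseteq> W \<odot> H"
  shows "H \<odot> (V \<odot> H) \<subseteq> W \<odot> H"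
proof -
  have "H \<odot> (V \<odot> H) = (H \<odot> V) \<odot> H"
    using set_oplus_assoc[of H V H] H_subset H_stable assms by simp
  also have "\<dots> \<subseteq> (W \<odot> H) \<odot> H"
    by (rule set_oplus_mono[OF assms(3) order_refl])
  also have "\<dots> = W \<odot> H" using assms nbhd_oplus_H by simp
  finally show ?thesis .
qed

lemma base_oplus:
  assumes "W \<in> \<U>"
  obtains U where "U \<in> \<U>" "U \<odot> U \<subseteq> W"
proof -
  obtain W' where W': "openin T W'" "\<zero> \<in> W'" "W' \<subseteq> W"
    using assms base_interior by metis
  have "openin (prod_topology T T) {p \<in> topspace (prod_topology T T). (case p of (x, y) \<Rightarrow> x \<oplus> y) \<in> W'}"
    using continuous_oplus W'(1) by (rule openin_continuous_map_preimage)
  moreover have "(\<zero>, \<zero>) \<in> {p \<in> topspace (prod_topology T T). (case p of (x, y) \<Rightarrow> x \<oplus> y) \<in> W'}"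
    using zero W' by simp
  ultimately obtain A B where AB: "openin T A" "openin T B" "\<zero> \<in> A" "\<zero> \<in> B"
    "A \<times> B \<subseteq> {p \<in> topspace (prod_topology T T). (case p of (x, y) \<Rightarrow> x \<oplus> y) \<in> W'}"
    unfolding openin_prod_topology_alt by meson
  then have "openin T (A \<inter> B)" "\<zero> \<in> A \<inter> B" by auto
  then obtain U where U: "U \<in> \<U>" "U \<subseteq> A \<inter> B"
    using base_below by metis
  then have "U \<odot> U \<subseteq> W" using AB(5) W'(3) by (fastforce elim!: set_oplusE)
  with U(1) show ?thesis by (rule that)
qed

text \<open>The image in \<open>G/H\<close> of the left uniformity of \<open>G\<close>, given by the
  existence of some representatives. The right factor \<open>H\<close> absorbs a change of
  \<open>b\<close>; a change of \<open>a\<close> puts \<open>H\<close> to the left of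
  \<open>W\<close>.\<close>

definition near :: "'a set \<Rightarrow> ('a set) rel" where
  "near W = {(\<pi> a, \<pi> b) | a b. a \<in> G \<and> b \<in> G \<and> b \<in> {a} \<odot> (W \<odot> H)}"

lemma nearI: "a \<in> G \<Longrightarrow> b \<in> G \<Longrightarrow> b \<in> {a} \<odot> (W \<odot> H) \<Longrightarrow> (\<pi> a, \<pi> b) \<in> near W"
  by (auto simp: near_def)

lemma near_mono: "V \<subseteq> W \<Longrightarrow> near V \<subseteq> near W"
  using set_oplus_mono[OF order_refl set_oplus_mono[OF _ order_refl]] unfolding near_def by blast

text \<open>Neutrality is what makes \<^const>\<open>near\<close> independent of representatives, up to shrinking.\<close>

lemma near_point:
  assumes "W \<in> \<U>"
  obtains V where "V \<in> \<U>" "\<And>a b. a \<in> G \<Longrightarrow> b \<in> G \<Longrightarrow> (\<pi> a, \<pi> b) \<in> near V \<Longrightarrow> b \<in> {a} \<odot> (W \<odot> H)"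
proof -
  obtain V where V: "V \<in> \<U>" "V \<subseteq> W" "H \<odot> V \<subseteq> W \<odot> H"
    using assms base_neutral by metis
  have "b \<in> {a} \<odot> (W \<odot> H)" if ab: "a \<in> G" "b \<in> G" "(\<pi> a, \<pi> b) \<in> near V" for a b
  proof -
    obtain a' b' where a': "a' \<in> G" "\<pi> a = \<pi> a'" and b': "b' \<in> G" "\<pi> b = \<pi> b'"
      and near: "b' \<in> {a'} \<odot> (V \<odot> H)"
      using ab(3) by (auto simp: near_def)
    have "b \<in> {b'} \<odot> H" "a' \<in> {a} \<odot> H"
      using coset_eq_iff[of b' b] coset_eq_iff[of a a'] ab a' b' by auto
    \<comment> \<open>The path from \<open>a\<close> to \<open>b\<close> through \<open>a'\<close>
      and \<open>b'\<close>: the first \<open>H\<close> is moved across \<open>V\<close> by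
      neutrality, the last one is absorbed.\<close>
    then have "b \<in> ((({a} \<odot> H) \<odot> (V \<odot> H)) \<odot> H)"
      using near by (meson empty_subsetI insert_subset order_refl set_oplus_mono subsetD)
    also have "((({a} \<odot> H) \<odot> (V \<odot> H)) \<odot> H) = ({a} \<odot> (H \<odot> (V \<odot> H))) \<odot> H"
      using ab V nbhd_stable H_subset by (subst set_oplus_assoc) auto
    also have "\<dots> \<subseteq> ({a} \<odot> (W \<odot> H)) \<odot> H"
      by (rule set_oplus_mono[OF set_oplus_mono[OF order_refl
            H_oplus_nbhd[OF base_subset[OF V(1)] base_subset[OF assms] V(3)]] order_refl])
    also have "\<dots> = {a} \<odot> ((W \<odot> H) \<odot> H)"
      using ab gyr_stable_subset[OF nbhd_stable[OF assms]] H_stable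
      by (intro set_oplus_assoc) auto
    also have "\<dots> = {a} \<odot> (W \<odot> H)"
      using assms base_subset nbhd_oplus_H by simp
    finally show ?thesis .
  qed
  with V(1) show ?thesis by (rule that)
qed

text \<open>The two relations may use different representatives of the middle coset, so
  \<open>near_point\<close> refers both to one \<open>b\<close>. Then
  \<open>V1 H V1 H \<subseteq> U U H \<subseteq> W H\<close>, by neutrality of \<open>V1\<close>
  relative to \<open>U\<close>.\<close>

lemma near_comp:
  assumes "W \<in> \<U>"
  obtains V where "V \<in> \<U>" "near V O near V \<subseteq> near W"
proof -
  obtain U where U: "U \<in> \<U>" "U \<odot> U \<subseteq> W" using assms base_oplus by metis
  obtain V1 where V1: "V1 \<in> \<U>" "V1 \<subseteq> U" "H \<odot> V1 \<subseteq> U \<odot> H" using U base_neutral by metis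
  obtain V where V: "V \<in> \<U>" "\<And>a b. a \<in> G \<Longrightarrow> b \<in> G \<Longrightarrow> (\<pi> a, \<pi> b) \<in> near V \<Longrightarrow> b \<in> {a} \<odot> (V1 \<odot> H)"
    using V1(1) near_point by metis
  have sub: "U \<subseteq> G" "V1 \<subseteq> G" "V1 \<odot> H \<subseteq> G"
    using U V1 base_subset H_subset set_oplus_closed by auto
  have "(V1 \<odot> H) \<odot> (V1 \<odot> H) = V1 \<odot> (H \<odot> (V1 \<odot> H))"
    using sub H_subset V1 nbhd_stable by (intro set_oplus_assoc) auto
  also have "\<dots> \<subseteq> U \<odot> (U \<odot> H)"
    by (rule set_oplus_mono[OF V1(2) H_oplus_nbhd[OF sub(2,1) V1(3)]])
  also have "\<dots> = (U \<odot> U) \<odot> H"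
    using sub H_stable by (intro set_oplus_assoc[symmetric]) auto
  also have "\<dots> \<subseteq> W \<odot> H" using U by (simp add: set_oplus_mono)
  finally have prod: "(V1 \<odot> H) \<odot> (V1 \<odot> H) \<subseteq> W \<odot> H" .
  have "near V O near V \<subseteq> near W"
  proof (rule subrelI)
    fix A C assume "(A, C) \<in> near V O near V"
    then obtain B where AB: "(A, B) \<in> near V" "(B, C) \<in> near V" by blast
    then obtain a b c where abc: "a \<in> G" "b \<in> G" "c \<in> G" "A = \<pi> a" "B = \<pi> b" "C = \<pi> c"
      unfolding near_def by blast
    then have b: "b \<in> {a} \<odot> (V1 \<odot> H)" and c: "c \<in> {b} \<odot> (V1 \<odot> H)"
      using V(2) AB by auto
    have "{b} \<odot> (V1 \<odot> H) \<subseteq> ({a} \<odot> (V1 \<odot> H)) \<odot> (V1 \<odot> H)"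
      using b by (intro set_oplus_mono) auto
    also have "\<dots> = {a} \<odot> ((V1 \<odot> H) \<odot> (V1 \<odot> H))"
      using abc sub V1 nbhd_stable by (intro set_oplus_assoc) auto
    also have "\<dots> \<subseteq> {a} \<odot> (W \<odot> H)"
      using prod by (simp add: set_oplus_mono)
    finally show "(A, C) \<in> near W" using c abc by (auto intro: nearI)
  qed
  with V(1) show ?thesis by (rule that)
qed

text \<open>From \<open>b = a \<oplus> (v \<oplus> h)\<close> one returns to \<open>a\<close> by
  \<open>\<ominus> (v \<oplus> h)\<close>. Up to a gyration this is
  \<open>\<ominus> h \<oplus> \<ominus> v\<close>, an element of
  \<open>H \<odot> V \<subseteq> W \<odot> H\<close>; injectivity of the gyration and stability of
  \<open>W \<odot> H\<close> remove it.\<close>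

lemma near_converse:
  assumes "W \<in> \<U>"
  obtains V where "V \<in> \<U>" "(near V)\<inverse> \<subseteq> near W"
proof -
  obtain V where V: "V \<in> \<U>" "V \<subseteq> W" "H \<odot> V \<subseteq> W \<odot> H"
    using assms base_neutral by metis
  have "(near V)\<inverse> \<subseteq> near W"
  proof (rule subrelI)
    fix B A assume "(B, A) \<in> (near V)\<inverse>"
    then obtain a b where ab: "a \<in> G" "b \<in> G" "A = \<pi> a" "B = \<pi> b" "b \<in> {a} \<odot> (V \<odot> H)"
      unfolding near_def by blast
    then obtain v h where vh: "v \<in> V" "h \<in> H" "b = a \<oplus> (v \<oplus> h)"
      by (auto elim!: set_oplusE)
    have "v \<in> G" "h \<in> G" using vh V base_subset H_subset by auto
    then have G: "v \<in> G" "h \<in> G" "v \<oplus> h \<in> G" "\<ominus> v \<in> G" "\<ominus> h \<in> G" "\<ominus> (v \<oplus> h) \<in> G"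
      by (simp_all add: closed neg)
    have "\<ominus> h \<oplus> \<ominus> v \<in> H \<odot> V"
      using vh V base_neg H_neg by (intro set_oplusI) auto
    then have "gyr (\<ominus> h) (\<ominus> v) (\<ominus> (v \<oplus> h)) \<in> W \<odot> H"
      using gyr_neg_oplus G V(3) by auto
    also have "W \<odot> H = gyr (\<ominus> h) (\<ominus> v) ` (W \<odot> H)"
      using nbhd_stable[OF assms] G by (simp add: gyr_stable_def)
    finally have k: "\<ominus> (v \<oplus> h) \<in> W \<odot> H"
      using gyr_inject[OF G(5,4) G(6)] gyr_stable_subset[OF nbhd_stable[OF assms]] by blast
    have "a \<oplus> ((v \<oplus> h) \<oplus> \<ominus> (v \<oplus> h)) \<in> {a} \<odot> ({v \<oplus> h} \<odot> (W \<odot> H))"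
      using k by (simp add: set_oplusI)
    also have "{a} \<odot> ({v \<oplus> h} \<odot> (W \<odot> H)) = ({a} \<odot> {v \<oplus> h}) \<odot> (W \<odot> H)"
      using ab G assms nbhd_stable by (intro set_oplus_assoc[symmetric]) auto
    finally have "a \<in> {b} \<odot> (W \<odot> H)"
      using G ab vh neg(3)[OF G(3)] by (simp add: set_oplus_singleton)
    then show "(B, A) \<in> near W" using ab by (auto intro: nearI)
  qed
  with V(1) show ?thesis by (rule that)
qed

lemma near_refl:
  assumes "W \<in> \<U>" "a \<in> G"
  shows "(\<pi> a, \<pi> a) \<in> near W"
proof (rule nearI)
  have "a \<oplus> (\<zero> \<oplus> \<zero>) \<in> {a} \<odot> (W \<odot> H)"
    using assms base_zero H_zero by (intro set_oplusI) auto
  then show "a \<in> {a} \<odot> (W \<odot> H)" using assms zero by simp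
qed (use assms in auto)

text \<open>This is what the triple products in the defining sequence are for: \<open>H\<close> lies
  in \<open>U (Suc n) \<odot> U (Suc n)\<close>, so the difference \<open>k\<close> lies in
  \<open>U (Suc n) \<odot> H \<subseteq> U n\<close> for all \<open>n\<close>.\<close>

lemma near_separated:
  assumes "a \<in> G" "b \<in> G" "\<And>W. W \<in> \<U> \<Longrightarrow> (\<pi> a, \<pi> b) \<in> near W"
  shows "\<pi> a = \<pi> b"
proof -
  define k where "k = \<ominus> a \<oplus> b"
  have k: "k \<in> G" "b = a \<oplus> k"
    using assms neg closed oplus_neg_cancel by (auto simp: k_def)
  obtain U where U: "\<And>n. U n \<in> \<U>" and H: "H = (\<Inter>n. U n)"
    and U_Suc: "\<And>n. U (Suc n) \<odot> (U (Suc n) \<odot> U (Suc n)) \<subseteq> U n"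
    using H_Inter by blast
  have "k \<in> U n" for n
  proof -
    obtain V where "V \<in> \<U>" "(\<pi> a, \<pi> b) \<in> near V \<Longrightarrow> b \<in> {a} \<odot> (U (Suc n) \<odot> H)"
      using near_point[OF U] assms(1,2) by metis
    then have "b \<in> {a} \<odot> (U (Suc n) \<odot> H)" using assms(3) by blast
    then obtain a' k' where "a' \<in> {a}" and k': "k' \<in> U (Suc n) \<odot> H" "b = a' \<oplus> k'"
      by (rule set_oplusE)
    moreover have "k' \<in> G" using k'(1) gyr_stable_subset[OF nbhd_stable[OF U]] by blast
    ultimately have "k \<in> U (Suc n) \<odot> H"
      using oplus_left_cancel[of a k k'] k assms by simp
    moreover have "H \<subseteq> U (Suc n) \<odot> U (Suc n)"
    proof
      fix h assume "h \<in> H"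
      then have "\<zero> \<oplus> h \<in> U (Suc n) \<odot> U (Suc n)" "\<zero> \<oplus> h = h"
        using H base_zero[OF U] H_subset by (auto intro!: set_oplusI)
      then show "h \<in> U (Suc n) \<odot> U (Suc n)" by simp
    qed
    then have "U (Suc n) \<odot> H \<subseteq> U (Suc n) \<odot> (U (Suc n) \<odot> U (Suc n))"
      by (simp add: set_oplus_mono)
    ultimately show ?thesis using U_Suc by blast
  qed
  then have "k \<in> H" by (simp add: H)
  then show ?thesis
    using coset_eq_iff assms k by (simp add: set_oplusI)
qed

text \<open>Translations act on cosets as image maps, without a choice of representatives; stability
  of \<open>H\<close> makes the image a coset again.\<close>

lemma image_coset:
  assumes "g \<in> G" "a \<in> G"
  shows "oplus g ` \<pi> a = \<pi> (g \<oplus> a)"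
proof -
  have "oplus g ` \<pi> a = {g} \<odot> ({a} \<odot> H)"
    by (auto simp: left_coset_eq set_oplus_def)
  also have "\<dots> = ({g} \<odot> {a}) \<odot> H"
    using assms H_stable by (intro set_oplus_assoc[symmetric]) auto
  finally show ?thesis by (simp add: left_coset_eq set_oplus_singleton)
qed

lemma near_translate:
  assumes "g \<in> G" "W \<in> \<U>" "(A, B) \<in> near W"
  shows "(oplus g ` A, oplus g ` B) \<in> near W"
proof -
  obtain a b where ab: "a \<in> G" "b \<in> G" "A = \<pi> a" "B = \<pi> b" "b \<in> {a} \<odot> (W \<odot> H)"
    using assms(3) unfolding near_def by blast
  then have "g \<oplus> b \<in> {g} \<odot> ({a} \<odot> (W \<odot> H))" by (simp add: set_oplusI)
  also have "\<dots> = ({g} \<odot> {a}) \<odot> (W \<odot> H)"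
    using assms ab nbhd_stable by (intro set_oplus_assoc[symmetric]) auto
  finally show ?thesis
    using ab assms image_coset closed by (auto simp: set_oplus_singleton intro: nearI)
qed

section \<open>Translations and the quotient topology\<close>

lemma topspace_coset_space: "topspace (coset_space T oplus H) = \<pi> ` G"
  by (simp add: coset_space_def topspace_quotient_topology)

lemma continuous_translate:
  assumes "g \<in> G"
  shows "continuous_map T T (oplus g)"
proof -
  have "continuous_map T (prod_topology T T) (\<lambda>x. (g, x))"
    using assms by (simp add: continuous_map_pairedI)
  from continuous_map_compose[OF this continuous_oplus] show ?thesis
    by (simp add: o_def)
qed

lemma openin_coset_space_near:
  "openin (coset_space T oplus H) W \<longleftrightarrow>
    W \<subseteq> \<pi> ` G \<and> (\<forall>A\<in>W. \<exists>E\<in>near ` \<U>. E `` {A} \<subseteq> W)"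
  unfolding coset_space_def openin_quotient_topology
proof (rule conj_cong[OF refl], rule iffI)
  assume W: "W \<subseteq> \<pi> ` G" and op: "openin T {x \<in> G. \<pi> x \<in> W}"
  show "\<forall>A\<in>W. \<exists>E\<in>near ` \<U>. E `` {A} \<subseteq> W"
  proof
    fix A assume "A \<in> W"
    then obtain a where a: "a \<in> G" "A = \<pi> a" using W by blast
    let ?P = "{x \<in> G. a \<oplus> x \<in> {x \<in> G. \<pi> x \<in> W}}"
    have "openin T ?P"
      using continuous_translate[OF a(1)] op by (rule openin_continuous_map_preimage)
    moreover have "\<zero> \<in> ?P" using a \<open>A \<in> W\<close> zero by simp
    ultimately obtain U where U: "U \<in> \<U>" "U \<subseteq> ?P" using base_below by metis
    obtain V where V: "V \<in> \<U>"
      "\<And>b. b \<in> G \<Longrightarrow> (\<pi> a, \<pi> b) \<in> near V \<Longrightarrow> b \<in> {a} \<odot> (U \<odot> H)"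
      using near_point[OF U(1)] a(1) by metis
    \<comment> \<open>Every such \<open>B\<close> is the coset of some \<open>a \<oplus> u\<close>
      with \<open>u\<close> in \<open>U\<close>, and \<open>U \<subseteq> ?P\<close> says that this
      coset belongs to \<open>W\<close>.\<close>
    have "near V `` {A} \<subseteq> W"
    proof
      fix B assume "B \<in> near V `` {A}"
      then obtain b where b: "b \<in> G" "B = \<pi> b" "(\<pi> a, \<pi> b) \<in> near V"
        using a by (auto simp: near_def)
      then have "b \<in> {a} \<odot> (U \<odot> H)" by (intro V(2))
      also have "{a} \<odot> (U \<odot> H) = ({a} \<odot> U) \<odot> H"
        using a U base_subset H_stable by (intro set_oplus_assoc[symmetric]) auto
      finally obtain u where "u \<in> U" "b \<in> {a \<oplus> u} \<odot> H"
        by (auto elim!: set_oplusE intro: set_oplusI)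
      then have "\<pi> (a \<oplus> u) = B" "\<pi> (a \<oplus> u) \<in> W"
        using U b coset_eq_iff[of "a \<oplus> u" b] by auto
      then show "B \<in> W" by simp
    qed
    then show "\<exists>E\<in>near ` \<U>. E `` {A} \<subseteq> W" using V(1) by blast
  qed
next
  assume W: "\<forall>A\<in>W. \<exists>E\<in>near ` \<U>. E `` {A} \<subseteq> W"
  show "openin T {x \<in> G. \<pi> x \<in> W}"
  proof (subst openin_subopen, intro ballI)
    fix a assume "a \<in> {x \<in> G. \<pi> x \<in> W}"
    then have a: "a \<in> G" "\<pi> a \<in> W" by auto
    then obtain U where U: "U \<in> \<U>" "near U `` {\<pi> a} \<subseteq> W" using W by blast
    obtain V where V: "openin T V" "\<zero> \<in> V" "V \<subseteq> U" using U base_interior by metis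
    \<comment> \<open>This is \<open>a \<oplus> V\<close>, written as a preimage so that openness
      follows from continuity of the translation by \<open>\<ominus> a\<close>.\<close>
    let ?N = "{b \<in> G. \<ominus> a \<oplus> b \<in> V}"
    have "openin T ?N"
      using continuous_translate[OF neg(1)[OF a(1)]] V(1) by (rule openin_continuous_map_preimage)
    moreover have "a \<in> ?N" using a neg V by simp
    moreover have "?N \<subseteq> {x \<in> G. \<pi> x \<in> W}"
    proof
      fix b assume b: "b \<in> ?N"
      then have "a \<oplus> ((\<ominus> a \<oplus> b) \<oplus> \<zero>) \<in> {a} \<odot> (U \<odot> H)"
        using V H_zero by (intro set_oplusI) auto
      then have "b \<in> {a} \<odot> (U \<odot> H)"
        using a b neg closed oplus_neg_cancel by simp
      then have "(\<pi> a, \<pi> b) \<in> near U" using a b by (auto intro: nearI)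
      then show "b \<in> {x \<in> G. \<pi> x \<in> W}" using U b by auto
    qed
    ultimately show "\<exists>N. openin T N \<and> a \<in> N \<and> N \<subseteq> {x \<in> G. \<pi> x \<in> W}" by blast
  qed
qed

lemma coset_space_homogeneous_uniform_base:
  "homogeneous_uniform_base (coset_space T oplus H) (near ` \<U>)"
proof
  show "near ` \<U> \<noteq> {}" using H_Inter by blast
next
  fix E F assume "E \<in> near ` \<U>" "F \<in> near ` \<U>"
  then obtain U V where UV: "U \<in> \<U>" "V \<in> \<U>" "E = near U" "F = near V" by blast
  then obtain W where W: "W \<in> \<U>" "W \<subseteq> U" "W \<subseteq> V" using base_directed by metis
  then have "near W \<subseteq> E \<inter> F" using near_mono[OF W(2)] near_mono[OF W(3)] UV by simp
  then show "\<exists>D\<in>near ` \<U>. D \<subseteq> E \<inter> F" using W(1) by blast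
next
  fix E A assume "E \<in> near ` \<U>" "A \<in> topspace (coset_space T oplus H)"
  then obtain W a where "W \<in> \<U>" "E = near W" "a \<in> G" "A = \<pi> a"
    unfolding topspace_coset_space by blast
  then show "(A, A) \<in> E" using near_refl by simp
next
  fix E assume "E \<in> near ` \<U>"
  then show "E \<subseteq> topspace (coset_space T oplus H) \<times> topspace (coset_space T oplus H)"
    by (auto simp: topspace_coset_space near_def)
next
  fix E assume "E \<in> near ` \<U>"
  then obtain W where W: "W \<in> \<U>" "E = near W" by blast
  obtain V where "V \<in> \<U>" "(near V)\<inverse> \<subseteq> near W" using W(1) by (rule near_converse)
  then show "\<exists>D\<in>near ` \<U>. D\<inverse> \<subseteq> E" using W(2) by blast
next
  fix E assume "E \<in> near ` \<U>"
  then obtain W where W: "W \<in> \<U>" "E = near W" by blast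
  obtain V where "V \<in> \<U>" "near V O near V \<subseteq> near W" using W(1) by (rule near_comp)
  then show "\<exists>D\<in>near ` \<U>. D O D \<subseteq> E" using W(2) by blast
next
  fix W
  show "openin (coset_space T oplus H) W \<longleftrightarrow> W \<subseteq> topspace (coset_space T oplus H) \<and>
      (\<forall>x\<in>W. \<exists>E\<in>near ` \<U>. E `` {x} \<subseteq> W)"
    unfolding topspace_coset_space by (rule openin_coset_space_near)
next
  fix A B assume "A \<in> topspace (coset_space T oplus H)" "B \<in> topspace (coset_space T oplus H)"
    and near: "\<And>E. E \<in> near ` \<U> \<Longrightarrow> (A, B) \<in> E"
  then obtain a b where ab: "a \<in> G" "b \<in> G" "A = \<pi> a" "B = \<pi> b"
    unfolding topspace_coset_space by blast
  then show "A = B" using near_separated[OF ab(1,2)] near by simp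
next
  fix A B assume "A \<in> topspace (coset_space T oplus H)" "B \<in> topspace (coset_space T oplus H)"
  then obtain a b where ab: "a \<in> G" "b \<in> G" "A = \<pi> a" "B = \<pi> b"
    unfolding topspace_coset_space by blast
  \<comment> \<open>The coset of \<open>a\<close> goes to that of \<open>\<zero>\<close> and then to
    that of \<open>b\<close>. The two translations stay separate, since
    \<open>b \<oplus> (\<ominus> a \<oplus> c)\<close> and
    \<open>(b \<oplus> \<ominus> a) \<oplus> c\<close> may differ.\<close>
  define f where "f C = oplus b ` oplus (\<ominus> a) ` C" for C
  have "f \<in> \<pi> ` G \<rightarrow> \<pi> ` G"
    using ab neg closed by (auto simp: f_def image_coset)
  moreover have "f A = B"
    using ab neg zero by (simp add: f_def image_coset)
  moreover have "(f C, f D) \<in> near W \<longleftrightarrow> (C, D) \<in> near W"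
    if W: "W \<in> \<U>" "C \<in> \<pi> ` G" "D \<in> \<pi> ` G" for W C D
  proof
    show "(f C, f D) \<in> near W" if "(C, D) \<in> near W"
      unfolding f_def using ab neg W that by (intro near_translate) auto
    \<comment> \<open>The inverse of \<open>f\<close> is again a product of two translations, so
      \<open>near_translate\<close> also yields the converse implication.\<close>
    have f_inverse: "oplus a ` oplus (\<ominus> b) ` f C = C" if C: "C \<in> \<pi> ` G" for C
    proof -
      obtain c where "c \<in> G" "C = \<pi> c" using C by blast
      then show ?thesis
        using ab by (simp add: f_def image_coset neg closed neg_oplus_cancel oplus_neg_cancel)
    qed
    assume "(f C, f D) \<in> near W"
    then have "(oplus a ` oplus (\<ominus> b) ` f C, oplus a ` oplus (\<ominus> b) ` f D) \<in> near W"
      using ab neg W by (intro near_translate) auto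
    then show "(C, D) \<in> near W" using f_inverse W by simp
  qed
  ultimately show "\<exists>f. f \<in> topspace (coset_space T oplus H) \<rightarrow> topspace (coset_space T oplus H) \<and>
      f A = B \<and> (\<forall>E\<in>near ` \<U>. \<forall>u\<in>topspace (coset_space T oplus H).
        \<forall>v\<in>topspace (coset_space T oplus H). (f u, f v) \<in> E \<longleftrightarrow> (u, v) \<in> E)"
    unfolding topspace_coset_space by blast
qed

end

theorem corollary3p14:
  fixes T :: "'a topology"
    and oplus :: "'a \<Rightarrow> 'a \<Rightarrow> 'a"
    and gyr :: "'a \<Rightarrow> 'a \<Rightarrow> 'a \<Rightarrow> 'a"
    and \<U> :: "'a set set"
    and H :: "'a set"
  assumes "strongly_topological_gyrogroup T oplus gyr \<U>"
    and "Hausdorff_space T"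
    and "\<And>U. U \<in> \<U> \<Longrightarrow> symmetric_in (topspace T) oplus U"
    and "admissible_subgyrogroup T oplus gyr H"
    and "generated_from T oplus H \<U>"
    and "neutral_subgyrogroup T oplus gyr H"
  shows "metrizable_space (coset_space T oplus H) \<longleftrightarrow>
         frechet_urysohn_space (coset_space T oplus H) \<and>
         has_omega_omega_base (coset_space T oplus H)"
proof -
  interpret neutral_quotient T oplus gyr \<U> H
    using assms by (simp add: neutral_quotient_def neutral_quotient_axioms_def)
  interpret homogeneous_uniform_base "coset_space T oplus H" "near ` \<U>"
    by (rule coset_space_homogeneous_uniform_base)
  have "left_coset oplus H \<zero> \<in> topspace (coset_space T oplus H)"
    using zero by (simp add: topspace_coset_space)
  then show ?thesis
    using metrizable_if_frechet_urysohn metrizable_imp_frechet_urysohn_space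
      metrizable_imp_omega_omega_base by blast
qed

end
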